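(* Let $R$ be a ring, $n$ a positive integer, and let $M$ be an object of $\mathcal{U}_n$ with factor modules $U^{(i)}=M^{(i)}/M^{(i-1)}$, $i=1,\dots,n$. Let $E_M$ be its endomorphism ring in $\mathcal{E}_n$. For every $i=1,\dots,n$, set $$I_{M,i,m}:=\{f\in E_M \mid f_i \text{ is not an injective right } R\text{-module morphism}\}$$ and $$I_{M,i,e}:=\{f\in E_M \mid f_i \text{ is not a surjective right } R\text{-module morphism}\}.$$ Then $I_{M,1,m},\dots,I_{M,n,m},I_{M,1,e},\dots,I_{M,n,e}$ are $2n$ two-sided completely prime ideals of $E_M$, and every proper right ideal of $E_M$ and every proper left ideal of $E_M$ is contained in one of these $2n$ ideals of $E_M$. Moreover, $E_M/J(E_M)$ is isomorphic to the direct product of $k$ division rings $D_1,\dots,D_k$ for some $k$ with $1\le k\le 2n$, where $$\{D_1,\dots,D_k\}\subseteq\{E_M/I_{M,1,m},\dots,E_M/I_{M,n,m},E_M/I_{M,1,e},\dots,E_M/I_{M,n,e}\}.$$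
   Context: Rings are associative with identity and modules are right unitary modules. Fix a ring $R$ and a positive integer $n$. The category $\mathcal{E}_n$ has as objects right $R$-modules $M$ with a fixed chain of submodules $0=M^{(0)}\le M^{(1)}\le\dots\le M^{(n)}=M$ (denoted simply by $M$); a morphism $M\to N$ in $\mathcal{E}_n$ is a right $R$-module morphism $f:M\to N$ with $f(M^{(i)})\subseteq N^{(i)}$ for every $i=1,\dots,n$. The module $M^{(i)}/M^{(i-1)}$ is the $i$-th factor module of $M$, and $f_i:M^{(i)}/M^{(i-1)}\to N^{(i)}/N^{(i-1)}$ denotes the right $R$-module morphism induced by $f$. Write $E_M:=\mathrm{End}_{\mathcal{E}_n}(M)$. A right $R$-module is uniserial if its lattice of submodules is linearly ordered under inclusion. $\mathcal{U}_n$ is the full subcategory of $\mathcal{E}_n$ consisting of the objects whose factor modules $M^{(i)}/M^{(i-1)}$, $i=1,\dots,n$, are all non-zero uniserial right $R$-modules. A completely prime ideal $P$ of a ring $S$ is a proper ideal $P$ of $S$ such that, for every $x,y\in S$, $xy\in P$ implies $x\in P$ or $y\in P$. $J(S)$ denotes the Jacobson radical of a ring $S$. *)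

theory Defs
  imports "HOL-Algebra.Chinese_Remainder" "HOL-Algebra.Module"
begin

text \<open>The library's locale \<^locale>\<open>module\<close> is about left modules over commutative rings.
  For right modules we reuse its record signature, reading \<open>a \<odot>\<^bsub>M\<^esub> x\<close> as the
  right action \<open>x a\<close>; hence the order of the scalars in \<open>rsmult_assoc\<close>, \<open>x (a b) = (x a) b\<close>.
  The side of the action is irrelevant to \<^locale>\<open>submodule\<close>, which is used as it stands.\<close>

locale right_module = R?: ring R + M?: abelian_group M
  for R :: "('a, 'r) ring_scheme" (structure) and M :: "('a, 'b, 'm) module_scheme" (structure) +
  assumes rsmult_closed:
      "\<lbrakk>a \<in> carrier R; x \<in> carrier M\<rbrakk> \<Longrightarrow> a \<odot>\<^bsub>M\<^esub> x \<in> carrier M"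
    and rsmult_add_scalar:
      "\<lbrakk>a \<in> carrier R; b \<in> carrier R; x \<in> carrier M\<rbrakk> \<Longrightarrow>
        (a \<oplus>\<^bsub>R\<^esub> b) \<odot>\<^bsub>M\<^esub> x = (a \<odot>\<^bsub>M\<^esub> x) \<oplus>\<^bsub>M\<^esub> (b \<odot>\<^bsub>M\<^esub> x)"
    and rsmult_add_vector:
      "\<lbrakk>a \<in> carrier R; x \<in> carrier M; y \<in> carrier M\<rbrakk> \<Longrightarrow>
        a \<odot>\<^bsub>M\<^esub> (x \<oplus>\<^bsub>M\<^esub> y) = (a \<odot>\<^bsub>M\<^esub> x) \<oplus>\<^bsub>M\<^esub> (a \<odot>\<^bsub>M\<^esub> y)"
    and rsmult_assoc:
      "\<lbrakk>a \<in> carrier R; b \<in> carrier R; x \<in> carrier M\<rbrakk> \<Longrightarrow>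
        (a \<otimes>\<^bsub>R\<^esub> b) \<odot>\<^bsub>M\<^esub> x = b \<odot>\<^bsub>M\<^esub> (a \<odot>\<^bsub>M\<^esub> x)"
    and rsmult_one:
      "x \<in> carrier M \<Longrightarrow> \<one>\<^bsub>R\<^esub> \<odot>\<^bsub>M\<^esub> x = x"

text \<open>Homomorphisms are extensional, so that equality of homomorphisms is HOL equality.\<close>

definition rmod_hom ::
    "('a, 'r) ring_scheme \<Rightarrow> ('a, 'b, 'm) module_scheme \<Rightarrow> ('a, 'c, 'k) module_scheme \<Rightarrow> ('b \<Rightarrow> 'c) set"
  where "rmod_hom R M N =
    {f \<in> carrier M \<rightarrow>\<^sub>E carrier N.
      (\<forall>x\<in>carrier M. \<forall>y\<in>carrier M. f (x \<oplus>\<^bsub>M\<^esub> y) = f x \<oplus>\<^bsub>N\<^esub> f y) \<and>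
      (\<forall>a\<in>carrier R. \<forall>x\<in>carrier M. f (a \<odot>\<^bsub>M\<^esub> x) = a \<odot>\<^bsub>N\<^esub> f x)}"

text \<open>The quotient of \<open>M\<close> by a submodule \<open>N\<close>, consisting of cosets as in \<^const>\<open>FactRing\<close>. All cosets in
  the union defining the action coincide. The record's ring multiplication and unit are not part
  of a module structure and are left unspecified.\<close>

definition quotient_module ::
    "('a, 'b, 'm) module_scheme \<Rightarrow> 'b set \<Rightarrow> ('a, 'b set) module"
  where "quotient_module M N =
    \<lparr>carrier = a_rcosets\<^bsub>M\<^esub> N, mult = undefined, one = undefined,
     zero = N, add = set_add M,
     smult = (\<lambda>a C. \<Union>x\<in>C. N +>\<^bsub>M\<^esub> (a \<odot>\<^bsub>M\<^esub> x))\<rparr>"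

definition uniserial :: "('a, 'r) ring_scheme \<Rightarrow> ('a, 'b, 'm) module_scheme \<Rightarrow> bool"
  where "uniserial R M \<longleftrightarrow>
    (\<forall>A B. submodule A R M \<longrightarrow> submodule B R M \<longrightarrow> A \<subseteq> B \<or> B \<subseteq> A)"

text \<open>An object of \<open>\<E>\<^sub>n\<close> is a pair of a module \<open>M\<close> and a chain \<open>F 0 \<subseteq> \<dots> \<subseteq> F n\<close>;
  the values of \<open>F\<close> beyond \<open>n\<close> are irrelevant.\<close>

locale En_object = right_module R M
  for R :: "('a, 'r) ring_scheme" (structure) and n :: nat and M :: "('a, 'b, 'm) module_scheme" (structure)
    and F :: "nat \<Rightarrow> 'b set" +
  assumes n_pos: "0 < n"
    and chain_submodule: "i \<le> n \<Longrightarrow> submodule (F i) R M"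
    and chain_bot: "F 0 = {\<zero>\<^bsub>M\<^esub>}"
    and chain_top: "F n = carrier M"
    and chain_mono: "i < n \<Longrightarrow> F i \<subseteq> F (Suc i)"

definition factor_module ::
    "('a, 'b, 'm) module_scheme \<Rightarrow> (nat \<Rightarrow> 'b set) \<Rightarrow> nat \<Rightarrow> ('a, 'b set) module"
  where "factor_module M F i = quotient_module (M\<lparr>carrier := F i\<rparr>) (F (i - 1))"

locale Un_object = En_object +
  assumes factor_uniserial: "i \<in> {1..n} \<Longrightarrow> uniserial R (factor_module M F i)"
    and factor_nonzero:
      "i \<in> {1..n} \<Longrightarrow> carrier (factor_module M F i) \<noteq> {\<zero>\<^bsub>factor_module M F i\<^esub>}"

definition En_hom ::
    "('a, 'r) ring_scheme \<Rightarrow> nat \<Rightarrow> ('a, 'b, 'm) module_scheme \<Rightarrow> (nat \<Rightarrow> 'b set)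
      \<Rightarrow> ('a, 'c, 'k) module_scheme \<Rightarrow> (nat \<Rightarrow> 'c set) \<Rightarrow> ('b \<Rightarrow> 'c) set"
  where "En_hom R n M F N G = {f \<in> rmod_hom R M N. \<forall>i\<in>{1..n}. f ` F i \<subseteq> G i}"

text \<open>The induced morphism \<open>f\<^sub>i\<close> between the \<open>i\<close>-th factor modules, sending the coset of \<open>x\<close> to the
  coset of \<open>f x\<close>; again all cosets in the union coincide.\<close>

definition factor_map ::
    "('a, 'b, 'm) module_scheme \<Rightarrow> (nat \<Rightarrow> 'b set) \<Rightarrow> ('a, 'c, 'k) module_scheme \<Rightarrow> (nat \<Rightarrow> 'c set)
      \<Rightarrow> nat \<Rightarrow> ('b \<Rightarrow> 'c) \<Rightarrow> 'b set \<Rightarrow> 'c set"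
  where "factor_map M F N G i f =
    (\<lambda>C\<in>carrier (factor_module M F i). \<Union>x\<in>C. G (i - 1) +>\<^bsub>N\<^esub> f x)"

definition En_End ::
    "('a, 'r) ring_scheme \<Rightarrow> nat \<Rightarrow> ('a, 'b, 'm) module_scheme \<Rightarrow> (nat \<Rightarrow> 'b set) \<Rightarrow> ('b \<Rightarrow> 'b) ring"
  where "En_End R n M F =
    \<lparr>carrier = En_hom R n M F M F,
     mult = compose (carrier M),
     one = (\<lambda>x\<in>carrier M. x),
     zero = (\<lambda>x\<in>carrier M. \<zero>\<^bsub>M\<^esub>),
     add = (\<lambda>f g. \<lambda>x\<in>carrier M. f x \<oplus>\<^bsub>M\<^esub> g x)\<rparr>"

definition I_m ::
    "('a, 'r) ring_scheme \<Rightarrow> nat \<Rightarrow> ('a, 'b, 'm) module_scheme \<Rightarrow> (nat \<Rightarrow> 'b set) \<Rightarrow> nat \<Rightarrow> ('b \<Rightarrow> 'b) set"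
  where "I_m R n M F i =
    {f \<in> carrier (En_End R n M F). \<not> inj_on (factor_map M F M F i f) (carrier (factor_module M F i))}"

definition I_e ::
    "('a, 'r) ring_scheme \<Rightarrow> nat \<Rightarrow> ('a, 'b, 'm) module_scheme \<Rightarrow> (nat \<Rightarrow> 'b set) \<Rightarrow> nat \<Rightarrow> ('b \<Rightarrow> 'b) set"
  where "I_e R n M F i =
    {f \<in> carrier (En_End R n M F).
      factor_map M F M F i f ` carrier (factor_module M F i) \<noteq> carrier (factor_module M F i)}"

locale right_ideal = additive_subgroup I S + ring S for I and S (structure) +
  assumes mult_right_closed: "\<lbrakk>a \<in> I; x \<in> carrier S\<rbrakk> \<Longrightarrow> a \<otimes> x \<in> I"

locale left_ideal = additive_subgroup I S + ring S for I and S (structure) +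
  assumes mult_left_closed: "\<lbrakk>a \<in> I; x \<in> carrier S\<rbrakk> \<Longrightarrow> x \<otimes> a \<in> I"

locale completely_prime_ideal = ideal P S for P and S (structure) +
  assumes proper: "P \<noteq> carrier S"
    and completely_prime:
      "\<lbrakk>x \<in> carrier S; y \<in> carrier S; x \<otimes> y \<in> P\<rbrakk> \<Longrightarrow> x \<in> P \<or> y \<in> P"

definition maximal_right_ideal :: "'a set \<Rightarrow> ('a, 'r) ring_scheme \<Rightarrow> bool"
  where "maximal_right_ideal I S \<longleftrightarrow>
    right_ideal I S \<and> I \<noteq> carrier S \<and>
    (\<forall>K. right_ideal K S \<longrightarrow> I \<subseteq> K \<longrightarrow> K = I \<or> K = carrier S)"

text \<open>Intersecting with the carrier makes the radical of the zero ring, which has no maximal right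
  ideals, the whole ring.\<close>

definition jacobson_radical :: "('a, 'r) ring_scheme \<Rightarrow> 'a set"
  where "jacobson_radical S = carrier S \<inter> \<Inter>{I. maximal_right_ideal I S}"

locale skew_field = ring D for D (structure) +
  assumes one_neq_zero: "\<one> \<noteq> \<zero>"
    and nonzero_Units: "Units D = carrier D - {\<zero>}"

end

theory Submission
  imports Defs
begin

text \<open>The theorem splits into a statement about modules and one about rings.

  Let \<open>f\<close> be an endomorphism of \<open>M\<close> in \<open>\<E>\<^sub>n\<close>. That \<open>f\<^sub>i\<close> fails to be injective means that the
  submodule \<open>factor_ker i f = {x \<in> F i. f x \<in> F (i - 1)}\<close> differs from \<open>F (i - 1)\<close>; that it fails to
  be surjective means that \<open>factor_im i f = F (i - 1) + f (F i)\<close> differs from \<open>F i\<close>. The submodules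
  between \<open>F (i - 1)\<close> and \<open>F i\<close> are totally ordered (\<open>chain_uniserial\<close>), so of two kernels or images
  one contains the other, and the two sets of endomorphisms are closed under sums. A kernel and an
  image are comparable as well, which gives that \<open>f g\<close> is injective, or surjective, on the \<open>i\<close>-th
  factor if and only if both \<open>f\<close> and \<open>g\<close> are (\<open>I_m_mult\<close>, \<open>I_e_mult\<close>); this one equivalence contains
  both the ideal property and complete primeness. By a five lemma for chains
  (\<open>E_Units_if_factors_bij\<close>), an endomorphism that lies in none of the \<open>2 n\<close> ideals is invertible.

  What remains holds in any ring in which finitely many completely prime ideals contain all the
  non-units. A proper one-sided ideal consists of non-units, so prime avoidance
  (\<open>completely_prime_avoidance\<close>) puts it inside one of the given ideals. Hence the ideals that are
  maximal under inclusion among the given ones are precisely the maximal right ideals. Their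
  intersection is the Jacobson radical, the quotients by them are division rings, and the Chinese
  remainder theorem applies to them (\<open>Quot_jacobson_radical_iso\<close>).\<close>

section \<open>Rings whose non-units are covered by finitely many completely prime ideals\<close>

context ring
begin

text \<open>The element is a product of elements of \<open>K\<close>, one from each member of \<open>\<Q>\<close> and none in \<open>P\<close>.\<close>

lemma ex_mem_Inter_not_mem:
  assumes "completely_prime_ideal P R"
    and "finite \<Q>" "\<Q> \<noteq> {}" "\<And>Q. Q \<in> \<Q> \<Longrightarrow> ideal Q R"
    and "K \<subseteq> carrier R" "\<And>x y. x \<in> K \<Longrightarrow> y \<in> K \<Longrightarrow> x \<otimes> y \<in> K"
    and "\<And>Q. Q \<in> \<Q> \<Longrightarrow> \<exists>x\<in>K \<inter> Q. x \<notin> P"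
  shows "\<exists>x\<in>K \<inter> \<Inter>\<Q>. x \<notin> P"
  using assms(2,3,4,7)
proof (induction \<Q> rule: finite_ne_induct)
  case (singleton Q)
  then show ?case by auto
next
  case (insert Q \<Q>)
  have "\<exists>y\<in>K \<inter> \<Inter>\<Q>. y \<notin> P"
    by (rule insert.IH) (use insert.prems in auto)
  then obtain y where y: "y \<in> K \<inter> \<Inter>\<Q>" "y \<notin> P" by blast
  obtain x where x: "x \<in> K \<inter> Q" "x \<notin> P" using insert.prems(2)[of Q] by blast
  have carr: "x \<in> carrier R" "y \<in> carrier R" using x y assms(5) by auto
  have "x \<otimes> y \<in> Q" using insert.prems x carr by (simp add: ideal.I_r_closed)
  moreover have "x \<otimes> y \<in> T" if "T \<in> \<Q>" for T
    using insert.prems(1)[of T] y carr that by (simp add: ideal.I_l_closed)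
  moreover have "x \<otimes> y \<notin> P"
    using completely_prime_ideal.completely_prime[OF assms(1) carr] x y by blast
  ultimately show ?case using x y assms(6) by blast
qed

text \<open>Prime avoidance. It suffices that \<open>K\<close> is an additive subgroup closed under multiplication, so
  that the lemma applies to right and to left ideals.\<close>

lemma completely_prime_avoidance:
  assumes "finite \<P>" "\<And>P. P \<in> \<P> \<Longrightarrow> completely_prime_ideal P R"
    and K: "additive_subgroup K R" and mult: "\<And>x y. x \<in> K \<Longrightarrow> y \<in> K \<Longrightarrow> x \<otimes> y \<in> K"
    and "K \<subseteq> \<Union>\<P>"
  shows "\<exists>P\<in>\<P>. K \<subseteq> P"
  using assms(1,2,5)
proof (induction \<P> rule: finite_psubset_induct)
  case (psubset \<P>)
  interpret K: additive_subgroup K R by (rule K)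
  show ?case
  proof (cases "\<exists>P\<in>\<P>. K \<subseteq> \<Union>(\<P> - {P})")
    case True
    then obtain P where P: "P \<in> \<P>" "K \<subseteq> \<Union>(\<P> - {P})" by blast
    have "\<exists>Q\<in>\<P> - {P}. K \<subseteq> Q"
      by (rule psubset.IH) (use P psubset.prems in auto)
    then show ?thesis by blast
  next
    case irredundant: False
    obtain P where P: "P \<in> \<P>" using psubset.prems(2) K.zero_closed by blast
    interpret P: completely_prime_ideal P R by (rule psubset.prems(1)[OF P])
    \<comment> \<open>In a family without superfluous members, each covers an element of \<open>K\<close> that no other does.\<close>
    have own: "\<exists>x\<in>K. x \<in> Q \<and> (\<forall>T\<in>\<P>. T \<noteq> Q \<longrightarrow> x \<notin> T)" if Q: "Q \<in> \<P>" for Q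
    proof -
      have "\<not> K \<subseteq> \<Union>(\<P> - {Q})" using irredundant Q by simp
      then obtain x where "x \<in> K" "x \<notin> \<Union>(\<P> - {Q})" by auto
      moreover have "x \<in> \<Union>\<P>" using psubset.prems(2) \<open>x \<in> K\<close> by (rule subsetD)
      ultimately show ?thesis by auto
    qed
    obtain x where x: "x \<in> K" "x \<in> P" "\<And>Q. Q \<in> \<P> \<Longrightarrow> Q \<noteq> P \<Longrightarrow> x \<notin> Q"
      using own[OF P] by auto
    show ?thesis
    proof (cases "\<P> = {P}")
      case True
      then show ?thesis using psubset.prems(2) by auto
    next
      case False
      have "\<exists>y\<in>K \<inter> \<Inter>(\<P> - {P}). y \<notin> P"
      proof (rule ex_mem_Inter_not_mem)
        show "\<exists>x\<in>K \<inter> Q. x \<notin> P" if "Q \<in> \<P> - {P}" for Q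
          using own[of Q] that P by auto
        show "ideal Q R" if "Q \<in> \<P> - {P}" for Q
          using completely_prime_ideal.axioms(1)[OF psubset.prems(1)[of Q]] that by simp
        show "\<P> - {P} \<noteq> {}" using False P by auto
      qed (use P.completely_prime_ideal_axioms psubset.hyps K.a_subset mult in auto)
      then obtain y where y: "y \<in> K" "y \<notin> P" "\<And>Q. Q \<in> \<P> \<Longrightarrow> Q \<noteq> P \<Longrightarrow> y \<in> Q" by auto
      have cancel: "b \<in> Q" if Q: "Q \<in> \<P>" and "a \<oplus> b \<in> Q" "a \<in> Q" "b \<in> carrier R" for Q a b
      proof -
        interpret Q: completely_prime_ideal Q R by (rule psubset.prems(1)[OF Q])
        have "\<ominus> a \<oplus> (a \<oplus> b) \<in> Q" using that by simp
        then show ?thesis using that Q.Icarr r_neg1 by auto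
      qed
      have carr: "x \<in> carrier R" "y \<in> carrier R" using x y K.a_subset by auto
      \<comment> \<open>\<open>x\<close> lies in \<open>P\<close> only and \<open>y\<close> in all the members but \<open>P\<close>, so the sum escapes from all of them.\<close>
      have "x \<oplus> y \<notin> Q" if "Q \<in> \<P>" for Q
      proof (cases "Q = P")
        case True
        then show ?thesis using cancel[OF P _ x(2) carr(2)] y(2) by auto
      next
        case False
        have "x \<oplus> y = y \<oplus> x" using carr a_comm by blast
        then show ?thesis using cancel[of Q y x] that x(3) y(3) carr False by auto
      qed
      moreover have "x \<oplus> y \<in> K" using x(1) y(1) by (rule K.a_closed)
      ultimately show ?thesis using psubset.prems(2) by auto
    qed
  qed
qed

end

lemma right_ideal_proper_disjoint_Units:
  assumes "right_ideal K S" "K \<noteq> carrier S"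
  shows "K \<inter> Units S = {}"
proof (rule ccontr)
  interpret right_ideal K S by (rule assms)
  assume "K \<inter> Units S \<noteq> {}"
  then obtain u where "u \<in> K" "u \<in> Units S" by blast
  then have one: "\<one>\<^bsub>S\<^esub> \<in> K" using mult_right_closed[of u "inv\<^bsub>S\<^esub> u"] by simp
  have "x \<in> K" if "x \<in> carrier S" for x using mult_right_closed[OF one that] that by simp
  then show False using assms(2) a_subset by blast
qed

lemma left_ideal_proper_disjoint_Units:
  assumes "left_ideal K S" "K \<noteq> carrier S"
  shows "K \<inter> Units S = {}"
proof (rule ccontr)
  interpret left_ideal K S by (rule assms)
  assume "K \<inter> Units S \<noteq> {}"
  then obtain u where "u \<in> K" "u \<in> Units S" by blast
  then have one: "\<one>\<^bsub>S\<^esub> \<in> K" using mult_left_closed[of u "inv\<^bsub>S\<^esub> u"] by simp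
  have "x \<in> K" if "x \<in> carrier S" for x using mult_left_closed[OF one that] that by simp
  then show False using assms(2) a_subset by blast
qed

lemma ideal_imp_right_ideal: "ideal P S \<Longrightarrow> right_ideal P S"
  by (simp add: right_ideal_def right_ideal_axioms_def ideal.axioms ideal.I_r_closed)

text \<open>A ring with a finite nonempty family of completely prime ideals outside which every element
  is invertible.\<close>

locale completely_prime_cover = ring S for S (structure) +
  fixes \<P> :: "'a set set"
  assumes finite_cover: "finite \<P>" and cover_nonempty: "\<P> \<noteq> {}"
    and cover_prime: "P \<in> \<P> \<Longrightarrow> completely_prime_ideal P S"
    and cover_Units: "x \<in> carrier S \<Longrightarrow> (\<And>P. P \<in> \<P> \<Longrightarrow> x \<notin> P) \<Longrightarrow> x \<in> Units S"
begin

lemma right_ideal_subset_cover: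
  assumes "right_ideal K S" "K \<noteq> carrier S"
  shows "\<exists>P\<in>\<P>. K \<subseteq> P"
proof -
  interpret right_ideal K S by (rule assms)
  show ?thesis
  proof (rule completely_prime_avoidance)
    show "K \<subseteq> \<Union>\<P>"
      using right_ideal_proper_disjoint_Units[OF assms] cover_Units a_subset by blast
  qed (use finite_cover cover_prime is_additive_subgroup mult_right_closed a_subset in auto)
qed

lemma left_ideal_subset_cover:
  assumes "left_ideal K S" "K \<noteq> carrier S"
  shows "\<exists>P\<in>\<P>. K \<subseteq> P"
proof -
  interpret left_ideal K S by (rule assms)
  show ?thesis
  proof (rule completely_prime_avoidance)
    show "K \<subseteq> \<Union>\<P>"
      using left_ideal_proper_disjoint_Units[OF assms] cover_Units a_subset by blast
  qed (use finite_cover cover_prime is_additive_subgroup mult_left_closed a_subset in auto)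
qed

text \<open>The members of the cover that are maximal under inclusion; distinct members of it are
  incomparable.\<close>

definition maximals :: "'a set set"
  where "maximals = {P \<in> \<P>. \<forall>Q\<in>\<P>. P \<subseteq> Q \<longrightarrow> P = Q}"

lemma right_ideal_subset_maximals:
  assumes "right_ideal K S" "K \<noteq> carrier S"
  shows "\<exists>P\<in>maximals. K \<subseteq> P"
proof -
  obtain Q where Q: "Q \<in> \<P>" "K \<subseteq> Q" using right_ideal_subset_cover[OF assms] by blast
  obtain P where "P \<in> \<P>" "Q \<subseteq> P" "\<forall>T\<in>\<P>. P \<subseteq> T \<longrightarrow> P = T"
    using finite_has_maximal2[OF finite_cover Q(1)] by blast
  then show ?thesis using Q unfolding maximals_def by blast
qed

lemma maximals_prime: "P \<in> maximals \<Longrightarrow> completely_prime_ideal P S"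
  unfolding maximals_def using cover_prime by blast

lemma maximals_ideal: "P \<in> maximals \<Longrightarrow> ideal P S"
  using maximals_prime completely_prime_ideal.axioms(1) by blast

lemma maximals_maximal_right_ideal:
  assumes "P \<in> maximals"
  shows "maximal_right_ideal P S"
  unfolding maximal_right_ideal_def
proof (intro conjI allI impI)
  show "right_ideal P S" using maximals_ideal[OF assms] ideal_imp_right_ideal by blast
  show "P \<noteq> carrier S" using maximals_prime[OF assms] completely_prime_ideal.proper by blast
  fix K assume K: "right_ideal K S" "P \<subseteq> K"
  show "K = P \<or> K = carrier S"
    using right_ideal_subset_cover[OF K(1)] K(2) assms unfolding maximals_def by blast
qed

lemma jacobson_radical_eq: "jacobson_radical S = \<Inter>maximals"
proof -
  have eq: "{I. maximal_right_ideal I S} = maximals"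
  proof (intro equalityI subsetI)
    fix I assume "I \<in> {I. maximal_right_ideal I S}"
    then have I: "right_ideal I S" "I \<noteq> carrier S"
      "\<And>K. right_ideal K S \<Longrightarrow> I \<subseteq> K \<Longrightarrow> K = I \<or> K = carrier S"
      unfolding maximal_right_ideal_def by auto
    obtain P where P: "P \<in> maximals" "I \<subseteq> P" using right_ideal_subset_maximals I(1,2) by blast
    then show "I \<in> maximals"
      using I(3)[of P] maximals_maximal_right_ideal[OF P(1)] unfolding maximal_right_ideal_def by auto
  qed (use maximals_maximal_right_ideal in auto)
  \<comment> \<open>There is a maximal right ideal, so the intersection with the carrier in the definition of the
    radical is redundant.\<close>
  have "right_ideal {\<zero>} S" using zeroideal ideal_imp_right_ideal by blast
  moreover have "{\<zero>} \<noteq> carrier S"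
  proof -
    obtain P where P: "P \<in> \<P>" using cover_nonempty by blast
    interpret P: completely_prime_ideal P S using cover_prime P by blast
    show ?thesis
    proof
      assume "{\<zero>} = carrier S"
      then have "carrier S \<subseteq> P" using P.zero_closed by (metis empty_subsetI insert_subset)
      then show False using P.proper P.a_subset by (simp add: subset_antisym)
    qed
  qed
  ultimately obtain P where P: "P \<in> maximals" using right_ideal_subset_maximals by blast
  have "P \<subseteq> carrier S"
    using maximals_ideal[OF P] ideal.axioms(1) additive_subgroup.a_subset by blast
  then show ?thesis using P unfolding jacobson_radical_def eq by blast
qed

lemma maximals_nonempty: "maximals \<noteq> {}"
proof -
  obtain P where P: "P \<in> \<P>" using cover_nonempty by blast
  interpret P: completely_prime_ideal P S using cover_prime P by blast
  show ?thesis using right_ideal_subset_maximals[of P] ideal_imp_right_ideal P.ideal_axioms P.proper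
    by blast
qed

lemma maximals_right_inverse:
  assumes P: "P \<in> maximals" and x: "x \<in> carrier S" "x \<notin> P"
  shows "\<exists>y\<in>carrier S. P +> (x \<otimes> y) = P +> \<one>"
proof -
  interpret P: ideal P S using P maximals_ideal by blast
  \<comment> \<open>\<open>P + x S\<close> is a right ideal that properly contains \<open>P\<close>.\<close>
  define K where "K = P <+>\<^bsub>S\<^esub> (\<lambda>y. x \<otimes> y) ` carrier S"
  have mem_K: "z \<in> K \<longleftrightarrow> (\<exists>p\<in>P. \<exists>y\<in>carrier S. z = p \<oplus> x \<otimes> y)" for z
    unfolding K_def set_add_def' by auto
  have "additive_subgroup ((\<lambda>y. x \<otimes> y) ` carrier S) S"
  proof (rule additive_subgroupI, rule add.subgroupI)
    fix a assume "a \<in> (\<lambda>y. x \<otimes> y) ` carrier S"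
    then obtain y where "y \<in> carrier S" "a = x \<otimes> y" by blast
    then have "\<ominus> a = x \<otimes> (\<ominus> y)" "\<ominus> y \<in> carrier S" using x r_minus by simp_all
    then show "\<ominus> a \<in> (\<lambda>y. x \<otimes> y) ` carrier S" by blast
  next
    fix a b assume "a \<in> (\<lambda>y. x \<otimes> y) ` carrier S" "b \<in> (\<lambda>y. x \<otimes> y) ` carrier S"
    then obtain y z where "y \<in> carrier S" "a = x \<otimes> y" "z \<in> carrier S" "b = x \<otimes> z" by blast
    then have "a \<oplus> b = x \<otimes> (y \<oplus> z)" "y \<oplus> z \<in> carrier S" using x r_distr by simp_all
    then show "a \<oplus> b \<in> (\<lambda>y. x \<otimes> y) ` carrier S" by blast
  qed (use x in auto)
  from add_additive_subgroups[OF P.is_additive_subgroup this]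
  have add: "additive_subgroup K S" unfolding K_def .
  have K_mult: "a \<otimes> b \<in> K" if a: "a \<in> K" and b: "b \<in> carrier S" for a b
  proof -
    from a mem_K[of a] obtain p y where py: "p \<in> P" "y \<in> carrier S" "a = p \<oplus> x \<otimes> y"
      by auto
    have "a \<otimes> b = p \<otimes> b \<oplus> x \<otimes> (y \<otimes> b)"
      unfolding py(3) using py(1,2) b x(1) P.Icarr[OF py(1)] by (simp add: l_distr m_assoc)
    moreover have "p \<otimes> b \<in> P" "y \<otimes> b \<in> carrier S" using py b P.I_r_closed by simp_all
    ultimately show ?thesis using mem_K[of "a \<otimes> b"] by auto
  qed
  have K: "right_ideal K S"
    by (intro right_ideal.intro right_ideal_axioms.intro add ring_axioms K_mult)
  have "P \<subseteq> K"
  proof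
    fix p assume p: "p \<in> P"
    then have "p = p \<oplus> x \<otimes> \<zero>" using x P.Icarr by simp
    then show "p \<in> K" using mem_K[of p] p by auto
  qed
  then have "K = P \<or> K = carrier S"
    using maximals_maximal_right_ideal[OF P] K unfolding maximal_right_ideal_def by auto
  moreover have "x \<in> K"
  proof -
    have "x = \<zero> \<oplus> x \<otimes> \<one>" using x by simp
    then show ?thesis using mem_K[of x] P.zero_closed one_closed by auto
  qed
  ultimately have "\<one> \<in> K" using x(2) by auto
  then obtain p y where py: "p \<in> P" "y \<in> carrier S" "\<one> = p \<oplus> x \<otimes> y"
    using mem_K[of \<one>] by auto
  have "\<one> \<in> P +> (x \<otimes> y)" using py(1,3) unfolding a_r_coset_def' by auto
  from a_repr_independence[OF this _ P.a_subgroup]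
  have "P +> (x \<otimes> y) = P +> \<one>" using py(2) x(1) by simp
  then show ?thesis using py(2) by auto
qed

lemma maximals_skew_field:
  assumes P: "P \<in> maximals"
  shows "skew_field (S Quot P)"
proof -
  interpret P: completely_prime_ideal P S using P maximals_prime by blast
  interpret Q: ring "S Quot P" by (rule P.quotient_is_ring)
  have carr: "carrier (S Quot P) = (\<lambda>a. P +> a) ` carrier S"
    by (auto simp: FactRing_def A_RCOSETS_def')
  have zero: "\<zero>\<^bsub>S Quot P\<^esub> = P" and one: "\<one>\<^bsub>S Quot P\<^esub> = P +> \<one>"
    by (auto simp: FactRing_def)
  have mult: "(P +> x) \<otimes>\<^bsub>S Quot P\<^esub> (P +> y) = P +> (x \<otimes> y)" if "x \<in> carrier S" "y \<in> carrier S" for x y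
    using that by (simp add: FactRing_def P.rcoset_mult_add)
  have neq: "\<one>\<^bsub>S Quot P\<^esub> \<noteq> \<zero>\<^bsub>S Quot P\<^esub>"
    unfolding zero one using P.rcos_const_imp_mem P.one_imp_carrier P.proper by blast
  have right_inv: "\<exists>b\<in>carrier (S Quot P) - {\<zero>\<^bsub>S Quot P\<^esub>}. a \<otimes>\<^bsub>S Quot P\<^esub> b = \<one>\<^bsub>S Quot P\<^esub>"
    if a: "a \<in> carrier (S Quot P)" "a \<noteq> \<zero>\<^bsub>S Quot P\<^esub>" for a
  proof -
    obtain x where x: "x \<in> carrier S" "a = P +> x" using a carr by blast
    have "x \<notin> P" using a x zero a_coset_join2[OF x(1) P.a_subgroup] by auto
    then obtain y where y: "y \<in> carrier S" "P +> (x \<otimes> y) = P +> \<one>"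
      using maximals_right_inverse[OF P x(1)] by blast
    have eq: "a \<otimes>\<^bsub>S Quot P\<^esub> (P +> y) = \<one>\<^bsub>S Quot P\<^esub>"
      using mult[OF x(1) y(1)] x(2) y(2) one by simp
    moreover have "P +> y \<in> carrier (S Quot P)" using y carr by blast
    moreover have "P +> y \<noteq> \<zero>\<^bsub>S Quot P\<^esub>" using eq neq Q.r_null[OF a(1)] by metis
    ultimately show ?thesis by blast
  qed
  show ?thesis
  proof unfold_locales
    show "Units (S Quot P) = carrier (S Quot P) - {\<zero>\<^bsub>S Quot P\<^esub>}"
    proof (intro equalityI subsetI)
      fix a assume a: "a \<in> Units (S Quot P)"
      then have "a \<noteq> \<zero>\<^bsub>S Quot P\<^esub>"
        using neq Q.Units_r_inv[OF a] Q.l_null[OF Q.Units_inv_closed[OF a]] by metis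
      then show "a \<in> carrier (S Quot P) - {\<zero>\<^bsub>S Quot P\<^esub>}"
        using Q.Units_closed[OF a] by simp
    next
      fix a assume a: "a \<in> carrier (S Quot P) - {\<zero>\<^bsub>S Quot P\<^esub>}"
      \<comment> \<open>A right inverse that itself has a right inverse is a two-sided inverse.\<close>
      obtain b where b: "b \<in> carrier (S Quot P) - {\<zero>\<^bsub>S Quot P\<^esub>}" "a \<otimes>\<^bsub>S Quot P\<^esub> b = \<one>\<^bsub>S Quot P\<^esub>"
        using right_inv a by blast
      obtain c where c: "c \<in> carrier (S Quot P)" "b \<otimes>\<^bsub>S Quot P\<^esub> c = \<one>\<^bsub>S Quot P\<^esub>"
        using right_inv[of b] b by blast
      have "a = c" by (rule Q.inv_unique[of a b c]) (use a b c in simp_all)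
      then have "b \<otimes>\<^bsub>S Quot P\<^esub> a = \<one>\<^bsub>S Quot P\<^esub>" using c by simp
      then show "a \<in> Units (S Quot P)" unfolding Units_def using a b by auto
    qed
  qed (rule neq)
qed

text \<open>The surjectivity half of the Chinese remainder theorem for the maximal members of the
  cover. The ring need not be commutative.\<close>

lemma maximals_simultaneous_congruence:
  fixes m :: nat
  assumes I: "inj_on I {..<m}" "\<And>i. i < m \<Longrightarrow> I i \<in> maximals"
    and a: "\<And>i. i < m \<Longrightarrow> a i \<in> carrier S"
  shows "\<exists>s\<in>carrier S. \<forall>i<m. I i +> s = I i +> a i"
  using I a
proof (induction m)
  case 0
  then show ?case by auto
next
  case (Suc m)
  have hom: "I i +> (x \<oplus> y) = (I i +> x) <+>\<^bsub>S\<^esub> (I i +> y)"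
    "[mod I i:] (I i +> x) \<Otimes> (I i +> y) = I i +> (x \<otimes> y)"
    if "i \<le> m" "x \<in> carrier S" "y \<in> carrier S" for i x y
    using ideal.rcoset_mult_add[OF maximals_ideal[OF Suc.prems(2)], of i x y]
      abelian_subgroup.a_rcos_sum[OF abelian_subgroupI3[OF ideal.axioms(1)[OF maximals_ideal[OF Suc.prems(2)]]
        is_abelian_group], of i x y] that by auto
  interpret P: completely_prime_ideal "I m" S using Suc.prems maximals_prime by blast
  obtain s where s: "s \<in> carrier S" "\<And>i. i < m \<Longrightarrow> I i +> s = I i +> a i"
    using Suc.IH Suc.prems by (auto simp: inj_on_def)
  have "\<exists>e\<in>carrier S. (\<forall>i<m. e \<in> I i) \<and> e \<notin> I m"
  proof (cases "m = 0")
    case True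
    then show ?thesis using P.one_imp_carrier P.proper by auto
  next
    case False
    have "\<exists>x\<in>carrier S \<inter> \<Inter>(I ` {..<m}). x \<notin> I m"
    proof (rule ex_mem_Inter_not_mem)
      show "completely_prime_ideal (I m) S" by unfold_locales
      fix Q assume "Q \<in> I ` {..<m}"
      then obtain i where i: "i < m" "Q = I i" by blast
      then have Q: "Q \<in> maximals" using Suc.prems(2) by simp
      show "ideal Q S" using Q maximals_ideal by blast
      then have sub: "Q \<subseteq> carrier S" using ideal.axioms(1) additive_subgroup.a_subset by blast
      have "Q \<noteq> I m" using i inj_onD[OF Suc.prems(1), of i m] by auto
      then have "\<not> Q \<subseteq> I m" using Q Suc.prems(2)[of m] unfolding maximals_def by auto
      then show "\<exists>x\<in>carrier S \<inter> Q. x \<notin> I m" using sub by auto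
    qed (use False in auto)
    then show ?thesis by auto
  qed
  then obtain e where e: "e \<in> carrier S" "\<And>i. i < m \<Longrightarrow> e \<in> I i" "e \<notin> I m" by auto
  obtain u where u: "u \<in> carrier S" "I m +> (e \<otimes> u) = I m +> \<one>"
    using maximals_right_inverse[of "I m" e] Suc.prems(2)[of m] e(1,3) by auto
  \<comment> \<open>Since \<open>e u\<close> is \<open>0\<close> modulo the earlier ideals and \<open>1\<close> modulo \<open>I m\<close>, adding \<open>e u (a m - s)\<close>
    corrects \<open>s\<close> modulo \<open>I m\<close> only.\<close>
  define d where "d = a m \<ominus> s"
  have am: "a m \<in> carrier S" using Suc.prems(3) by simp
  have d: "d \<in> carrier S" unfolding d_def using am s(1) by simp
  have "s \<oplus> d = a m \<oplus> (s \<oplus> \<ominus> s)"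
    unfolding d_def a_minus_def using a_lcomm[of s "a m" "\<ominus> s"] am s(1) by simp
  then have sd: "s \<oplus> d = a m" using r_neg[OF s(1)] am by simp
  define t where "t = s \<oplus> e \<otimes> u \<otimes> d"
  have t: "t \<in> carrier S" unfolding t_def using s e u d by simp
  have "I i +> t = I i +> a i" if i: "i < Suc m" for i
  proof (cases "i < m")
    case True
    interpret Q: ideal "I i" S using maximals_ideal Suc.prems(2) i by blast
    have "e \<otimes> u \<otimes> d \<in> I i" using e(2)[OF True] u d Q.I_r_closed by simp
    then have "I i +> (e \<otimes> u \<otimes> d) = I i +> \<zero>"
      using a_coset_join2[OF _ Q.a_subgroup] Q.Icarr Q.zero_closed by simp
    then have "I i +> t = I i +> (s \<oplus> \<zero>)"
      unfolding t_def using hom(1)[of i s "e \<otimes> u \<otimes> d"] hom(1)[of i s \<zero>] i s(1) e(1) u(1) d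
      by auto
    then show ?thesis using s True by simp
  next
    case False
    then have "i = m" using i by simp
    have "I m +> (e \<otimes> u \<otimes> d) = I m +> (\<one> \<otimes> d)"
      using hom(2)[of m "e \<otimes> u" d] hom(2)[of m \<one> d] u e d by simp
    then have "I m +> t = I m +> (s \<oplus> d)"
      unfolding t_def using hom(1)[of m s "e \<otimes> u \<otimes> d"] hom(1)[of m s d] s(1) e(1) u(1) d
      by auto
    then show ?thesis using sd \<open>i = m\<close> by simp
  qed
  then show ?case using t by auto
qed

lemma Quot_jacobson_radical_iso:
  assumes I: "bij_betw I {..<Suc m} maximals"
  shows "S Quot jacobson_radical S \<simeq> RDirProd_list (map (\<lambda>i. S Quot I i) [0..<Suc m])"
proof -
  have mem: "I i \<in> maximals" if "i \<le> m" for i using I that unfolding bij_betw_def by auto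
  have ideals: "ideal (I i) S" if "i \<le> m" for i using mem[OF that] maximals_ideal by blast
  let ?D = "RDirProd_list (map (\<lambda>i. S Quot I i) [0..<Suc m])"
  interpret h: ring_hom_ring S ?D "canonical_proj_ext I m"
    by (rule canonical_proj_ext_ring_hom[OF ideals])
  have "canonical_proj_ext I m ` carrier S = carrier ?D"
  proof (intro equalityI subsetI)
    fix ds assume ds: "ds \<in> carrier ?D"
    have len: "length ds = Suc m" using RDirProd_list_carrier_mem(1)[OF ds] by simp
    have "\<exists>a\<in>carrier S. ds ! i = I i +> a" if "i < Suc m" for i
    proof -
      have "ds ! i \<in> carrier (S Quot I i)"
        using RDirProd_list_carrier_mem(2)[OF ds, of i] that by (simp del: upt_Suc)
      then show ?thesis by (auto simp: FactRing_def A_RCOSETS_def')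
    qed
    then obtain a where a: "\<And>i. i < Suc m \<Longrightarrow> a i \<in> carrier S \<and> ds ! i = I i +> a i" by metis
    obtain s where s: "s \<in> carrier S" "\<forall>i<Suc m. I i +> s = I i +> a i"
      using maximals_simultaneous_congruence[of I "Suc m" a] I a mem
      unfolding bij_betw_def less_Suc_eq_le by blast
    have "ds = canonical_proj_ext I m s"
      unfolding canonical_proj_ext_def
      by (rule nth_equalityI) (use len s a in \<open>auto simp del: upt_Suc\<close>)
    then show "ds \<in> canonical_proj_ext I m ` carrier S" using s by blast
  qed (use h.hom_closed in blast)
  then have "S Quot a_kernel S ?D (canonical_proj_ext I m) \<simeq> ?D" by (rule h.FactRing_iso)
  moreover have "a_kernel S ?D (canonical_proj_ext I m) = (\<Inter>i\<le>m. I i)"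
    by (rule canonical_proj_ext_ker[OF ideals])
  moreover have "(\<Inter>i\<le>m. I i) = \<Inter>maximals"
    using I unfolding bij_betw_def by (simp add: lessThan_Suc_atMost)
  ultimately show ?thesis by (simp add: jacobson_radical_eq)
qed

end

section \<open>Chains of submodules and their endomorphisms\<close>

context En_object
begin

text \<open>The endomorphism ring of the object \<open>(M, F)\<close>.\<close>

abbreviation E :: "('b \<Rightarrow> 'b) ring"
  where "E \<equiv> En_End R n M F"

lemma chain_zero: "i \<le> n \<Longrightarrow> \<zero>\<^bsub>M\<^esub> \<in> F i"
  using submodule.axioms(1)[OF chain_submodule] subgroup.one_closed by fastforce

lemma chain_add: "i \<le> n \<Longrightarrow> x \<in> F i \<Longrightarrow> y \<in> F i \<Longrightarrow> x \<oplus>\<^bsub>M\<^esub> y \<in> F i"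
  using submodule.axioms(1)[OF chain_submodule] subgroup.m_closed by fastforce

lemma chain_neg: "i \<le> n \<Longrightarrow> x \<in> F i \<Longrightarrow> \<ominus>\<^bsub>M\<^esub> x \<in> F i"
  using submodule.axioms(1)[OF chain_submodule, of i] subgroup.m_inv_closed[of "F i" "add_monoid M" x]
  by (simp add: a_inv_def)

lemma chain_smult: "i \<le> n \<Longrightarrow> a \<in> carrier R \<Longrightarrow> x \<in> F i \<Longrightarrow> a \<odot>\<^bsub>M\<^esub> x \<in> F i"
  using submodule.smult_closed[OF chain_submodule] by blast

lemma chain_carrier: "i \<le> n \<Longrightarrow> x \<in> F i \<Longrightarrow> x \<in> carrier M"
  using submodule.axioms(1)[OF chain_submodule] subgroup.subset by fastforce

lemma chain_subgroup: "i \<le> n \<Longrightarrow> subgroup (F i) (add_monoid M)"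
  using submodule.axioms(1)[OF chain_submodule] .

lemma smult_zero: "a \<in> carrier R \<Longrightarrow> a \<odot>\<^bsub>M\<^esub> \<zero>\<^bsub>M\<^esub> = \<zero>\<^bsub>M\<^esub>"
  using rsmult_add_vector[of a "\<zero>\<^bsub>M\<^esub>" "\<zero>\<^bsub>M\<^esub>"] rsmult_closed[of a "\<zero>\<^bsub>M\<^esub>"]
  by (metis M.zero_closed M.l_zero M.add.r_cancel_one')

lemma smult_neg:
  assumes "a \<in> carrier R" "x \<in> carrier M"
  shows "a \<odot>\<^bsub>M\<^esub> (\<ominus>\<^bsub>M\<^esub> x) = \<ominus>\<^bsub>M\<^esub> (a \<odot>\<^bsub>M\<^esub> x)"
proof -
  have "(a \<odot>\<^bsub>M\<^esub> (\<ominus>\<^bsub>M\<^esub> x)) \<oplus>\<^bsub>M\<^esub> (a \<odot>\<^bsub>M\<^esub> x) = \<zero>\<^bsub>M\<^esub>"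
    using assms rsmult_add_vector[of a "\<ominus>\<^bsub>M\<^esub> x" x] smult_zero M.l_neg by simp
  then show ?thesis using M.minus_equality assms rsmult_closed by simp
qed

lemma E_carrierI:
  assumes "\<And>x. x \<in> carrier M \<Longrightarrow> f x \<in> carrier M" "\<And>x. x \<notin> carrier M \<Longrightarrow> f x = undefined"
    and "\<And>x y. x \<in> carrier M \<Longrightarrow> y \<in> carrier M \<Longrightarrow> f (x \<oplus>\<^bsub>M\<^esub> y) = f x \<oplus>\<^bsub>M\<^esub> f y"
    and "\<And>a x. a \<in> carrier R \<Longrightarrow> x \<in> carrier M \<Longrightarrow> f (a \<odot>\<^bsub>M\<^esub> x) = a \<odot>\<^bsub>M\<^esub> f x"
    and "\<And>i x. i \<in> {1..n} \<Longrightarrow> x \<in> F i \<Longrightarrow> x \<in> carrier M \<Longrightarrow> f x \<in> F i"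
  shows "f \<in> carrier E"
  unfolding En_End_def En_hom_def rmod_hom_def using assms chain_carrier
  by (auto simp: PiE_def extensional_def)

lemma E_closed: "f \<in> carrier E \<Longrightarrow> x \<in> carrier M \<Longrightarrow> f x \<in> carrier M"
  unfolding En_End_def En_hom_def rmod_hom_def by auto

lemma E_undefined: "f \<in> carrier E \<Longrightarrow> x \<notin> carrier M \<Longrightarrow> f x = undefined"
  unfolding En_End_def En_hom_def rmod_hom_def by auto

lemma E_add:
  "f \<in> carrier E \<Longrightarrow> x \<in> carrier M \<Longrightarrow> y \<in> carrier M \<Longrightarrow> f (x \<oplus>\<^bsub>M\<^esub> y) = f x \<oplus>\<^bsub>M\<^esub> f y"
  unfolding En_End_def En_hom_def rmod_hom_def by auto

lemma E_smult:
  "f \<in> carrier E \<Longrightarrow> a \<in> carrier R \<Longrightarrow> x \<in> carrier M \<Longrightarrow> f (a \<odot>\<^bsub>M\<^esub> x) = a \<odot>\<^bsub>M\<^esub> f x"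
  unfolding En_End_def En_hom_def rmod_hom_def by auto

lemma E_zero:
  assumes f: "f \<in> carrier E"
  shows "f \<zero>\<^bsub>M\<^esub> = \<zero>\<^bsub>M\<^esub>"
proof -
  have "f \<zero>\<^bsub>M\<^esub> = f \<zero>\<^bsub>M\<^esub> \<oplus>\<^bsub>M\<^esub> f \<zero>\<^bsub>M\<^esub>" using E_add[OF f, of "\<zero>\<^bsub>M\<^esub>" "\<zero>\<^bsub>M\<^esub>"] by simp
  then show ?thesis using M.add.r_cancel_one'[of "f \<zero>\<^bsub>M\<^esub>" "f \<zero>\<^bsub>M\<^esub>"] E_closed[OF f] by simp
qed

lemma E_neg:
  assumes f: "f \<in> carrier E" and x: "x \<in> carrier M"
  shows "f (\<ominus>\<^bsub>M\<^esub> x) = \<ominus>\<^bsub>M\<^esub> f x"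
proof -
  have "f (\<ominus>\<^bsub>M\<^esub> x) \<oplus>\<^bsub>M\<^esub> f x = \<zero>\<^bsub>M\<^esub>"
    using E_add[OF f, of "\<ominus>\<^bsub>M\<^esub> x" x] E_zero[OF f] x M.l_neg by simp
  then show ?thesis using M.minus_equality E_closed[OF f] x by simp
qed

lemma E_minus:
  "f \<in> carrier E \<Longrightarrow> x \<in> carrier M \<Longrightarrow> y \<in> carrier M \<Longrightarrow> f (x \<ominus>\<^bsub>M\<^esub> y) = f x \<ominus>\<^bsub>M\<^esub> f y"
  unfolding a_minus_def by (simp add: E_add E_neg)

lemma E_chain: "f \<in> carrier E \<Longrightarrow> i \<le> n \<Longrightarrow> x \<in> F i \<Longrightarrow> f x \<in> F i"
proof (cases "i = 0")
  case True
  then show "f \<in> carrier E \<Longrightarrow> x \<in> F i \<Longrightarrow> f x \<in> F i"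
    using chain_bot E_zero by simp
next
  case False
  then show "f \<in> carrier E \<Longrightarrow> i \<le> n \<Longrightarrow> x \<in> F i \<Longrightarrow> f x \<in> F i"
    unfolding En_End_def En_hom_def by force
qed

lemma E_ext:
  assumes "f \<in> carrier E" "g \<in> carrier E" "\<And>x. x \<in> carrier M \<Longrightarrow> f x = g x"
  shows "f = g"
proof
  show "f x = g x" for x
    using assms(3) E_undefined[OF assms(1)] E_undefined[OF assms(2)] by (cases "x \<in> carrier M") simp_all
qed

lemma E_zero_apply: "\<zero>\<^bsub>E\<^esub> = (\<lambda>x\<in>carrier M. \<zero>\<^bsub>M\<^esub>)"
  and E_one_apply: "\<one>\<^bsub>E\<^esub> = (\<lambda>x\<in>carrier M. x)"
  and E_add_apply: "f \<oplus>\<^bsub>E\<^esub> g = (\<lambda>x\<in>carrier M. f x \<oplus>\<^bsub>M\<^esub> g x)"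
  and E_mult_apply: "f \<otimes>\<^bsub>E\<^esub> g = (\<lambda>x\<in>carrier M. f (g x))"
  unfolding En_End_def by (simp_all add: compose_def)

lemma E_zero_closed: "\<zero>\<^bsub>E\<^esub> \<in> carrier E"
  by (rule E_carrierI) (simp_all add: E_zero_apply rsmult_closed smult_zero chain_zero chain_carrier)

lemma E_one_closed: "\<one>\<^bsub>E\<^esub> \<in> carrier E"
  by (rule E_carrierI) (simp_all add: E_one_apply rsmult_closed chain_carrier)

lemma E_add_closed:
  assumes "f \<in> carrier E" "g \<in> carrier E"
  shows "f \<oplus>\<^bsub>E\<^esub> g \<in> carrier E"
proof (rule E_carrierI)
  fix x y assume "x \<in> carrier M" "y \<in> carrier M"
  then show "(f \<oplus>\<^bsub>E\<^esub> g) (x \<oplus>\<^bsub>M\<^esub> y) = (f \<oplus>\<^bsub>E\<^esub> g) x \<oplus>\<^bsub>M\<^esub> (f \<oplus>\<^bsub>E\<^esub> g) y"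
    using assms E_closed by (simp add: E_add_apply E_add M.a_ac)
qed (use assms in \<open>simp_all add: E_add_apply E_closed E_smult rsmult_add_vector rsmult_closed
      E_chain chain_add chain_carrier\<close>)

lemma E_mult_closed:
  assumes "f \<in> carrier E" "g \<in> carrier E"
  shows "f \<otimes>\<^bsub>E\<^esub> g \<in> carrier E"
  by (rule E_carrierI)
    (use assms in \<open>simp_all add: E_mult_apply E_closed E_add E_smult rsmult_closed E_chain chain_carrier\<close>)

lemma E_neg_closed:
  assumes "f \<in> carrier E"
  shows "(\<lambda>x\<in>carrier M. \<ominus>\<^bsub>M\<^esub> f x) \<in> carrier E"
  by (rule E_carrierI)
    (use assms in \<open>simp_all add: E_closed E_add E_smult rsmult_closed smult_neg E_chain chain_neg
      M.minus_add chain_carrier\<close>)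

lemma E_ring: "ring E"
proof (rule ringI)
  show "abelian_group E"
  proof (rule abelian_groupI)
    fix f assume f: "f \<in> carrier E"
    have "(\<lambda>x\<in>carrier M. \<ominus>\<^bsub>M\<^esub> f x) \<oplus>\<^bsub>E\<^esub> f = \<zero>\<^bsub>E\<^esub>"
      by (rule E_ext) (use f in \<open>simp_all add: E_add_closed E_neg_closed E_zero_closed,
          simp add: E_add_apply E_zero_apply M.l_neg E_closed\<close>)
    then show "\<exists>g\<in>carrier E. g \<oplus>\<^bsub>E\<^esub> f = \<zero>\<^bsub>E\<^esub>" using E_neg_closed[OF f] by blast
    show "\<zero>\<^bsub>E\<^esub> \<oplus>\<^bsub>E\<^esub> f = f"
      by (rule E_ext) (use f in \<open>simp_all add: E_add_closed E_zero_closed,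
          simp add: E_add_apply E_zero_apply E_closed\<close>)
  next
    fix f g assume "f \<in> carrier E" "g \<in> carrier E"
    then show "f \<oplus>\<^bsub>E\<^esub> g = g \<oplus>\<^bsub>E\<^esub> f"
      by (intro E_ext) (simp_all add: E_add_closed, simp add: E_add_apply E_closed M.a_comm)
  next
    fix f g h assume "f \<in> carrier E" "g \<in> carrier E" "h \<in> carrier E"
    then show "f \<oplus>\<^bsub>E\<^esub> g \<oplus>\<^bsub>E\<^esub> h = f \<oplus>\<^bsub>E\<^esub> (g \<oplus>\<^bsub>E\<^esub> h)"
      by (intro E_ext) (simp_all add: E_add_closed, simp add: E_add_apply E_closed M.a_assoc)
  qed (simp_all add: E_zero_closed E_add_closed)
  show "monoid E"
  proof (rule monoidI)
    fix f g h assume "f \<in> carrier E" "g \<in> carrier E" "h \<in> carrier E"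
    then show "f \<otimes>\<^bsub>E\<^esub> g \<otimes>\<^bsub>E\<^esub> h = f \<otimes>\<^bsub>E\<^esub> (g \<otimes>\<^bsub>E\<^esub> h)"
      by (intro E_ext) (simp_all add: E_mult_closed, simp add: E_mult_apply E_closed)
  next
    fix f assume f: "f \<in> carrier E"
    show "\<one>\<^bsub>E\<^esub> \<otimes>\<^bsub>E\<^esub> f = f"
      by (rule E_ext) (use f in \<open>simp_all add: E_mult_closed E_one_closed, simp add: E_mult_apply
          E_one_apply E_closed\<close>)
    show "f \<otimes>\<^bsub>E\<^esub> \<one>\<^bsub>E\<^esub> = f"
      by (rule E_ext) (use f in \<open>simp_all add: E_mult_closed E_one_closed, simp add: E_mult_apply
          E_one_apply E_closed\<close>)
  qed (simp_all add: E_one_closed E_mult_closed)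
  fix f g h assume fgh: "f \<in> carrier E" "g \<in> carrier E" "h \<in> carrier E"
  show "(f \<oplus>\<^bsub>E\<^esub> g) \<otimes>\<^bsub>E\<^esub> h = f \<otimes>\<^bsub>E\<^esub> h \<oplus>\<^bsub>E\<^esub> g \<otimes>\<^bsub>E\<^esub> h"
    by (rule E_ext) (use fgh in \<open>simp_all add: E_mult_closed E_add_closed, simp add: E_mult_apply
        E_add_apply E_closed\<close>)
  show "h \<otimes>\<^bsub>E\<^esub> (f \<oplus>\<^bsub>E\<^esub> g) = h \<otimes>\<^bsub>E\<^esub> f \<oplus>\<^bsub>E\<^esub> h \<otimes>\<^bsub>E\<^esub> g"
    by (rule E_ext) (use fgh in \<open>simp_all add: E_mult_closed E_add_closed, simp add: E_mult_apply
        E_add_apply E_closed E_add\<close>)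
qed

text \<open>The inverse of a bijective endomorphism respects the chain as soon as each \<open>F i\<close> is mapped
  onto itself.\<close>

lemma E_UnitsI:
  assumes f: "f \<in> carrier E" and inj: "inj_on f (carrier M)"
    and surj: "\<And>i. i \<le> n \<Longrightarrow> F i \<subseteq> f ` F i"
  shows "f \<in> Units E"
proof -
  define g where "g = (\<lambda>y\<in>carrier M. inv_into (carrier M) f y)"
  have onto: "f ` carrier M = carrier M" using surj[of n] chain_top E_closed[OF f] by auto
  have fg: "f (g y) = y" if "y \<in> carrier M" for y
    using that onto unfolding g_def by (simp add: f_inv_into_f)
  have g_carr: "g y \<in> carrier M" if "y \<in> carrier M" for y
    using that onto unfolding g_def by (simp add: inv_into_into)
  have gI: "g y = x" if "x \<in> carrier M" "f x = y" for x y
    using inv_into_f_f[OF inj that(1)] E_closed[OF f that(1)] that(2) unfolding g_def by simp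
  have g: "g \<in> carrier E"
  proof (rule E_carrierI)
    fix x y assume "x \<in> carrier M" "y \<in> carrier M"
    then show "g (x \<oplus>\<^bsub>M\<^esub> y) = g x \<oplus>\<^bsub>M\<^esub> g y"
      using gI[of "g x \<oplus>\<^bsub>M\<^esub> g y"] by (simp add: g_carr fg E_add[OF f])
  next
    fix a x assume "a \<in> carrier R" "x \<in> carrier M"
    then show "g (a \<odot>\<^bsub>M\<^esub> x) = a \<odot>\<^bsub>M\<^esub> g x"
      using gI[of "a \<odot>\<^bsub>M\<^esub> g x"] by (simp add: g_carr fg E_smult[OF f] rsmult_closed)
  next
    fix i y assume i: "i \<in> {1..n}" "y \<in> F i"
    then obtain x where "x \<in> F i" "f x = y" using surj[of i] by auto
    then show "g y \<in> F i" using gI[of x y] i chain_carrier[of i x] by simp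
  qed (auto simp: g_carr, simp add: g_def)
  have "f \<otimes>\<^bsub>E\<^esub> g = \<one>\<^bsub>E\<^esub>"
    by (simp add: E_mult_apply E_one_apply fg cong: restrict_cong)
  moreover have "g \<otimes>\<^bsub>E\<^esub> f = \<one>\<^bsub>E\<^esub>"
    by (simp add: E_mult_apply E_one_apply gI cong: restrict_cong)
  ultimately show ?thesis using f g unfolding Units_def by auto
qed

end

section \<open>Factor modules, kernels and images\<close>

lemma (in right_module) submoduleI:
  assumes "A \<subseteq> carrier M" "\<zero>\<^bsub>M\<^esub> \<in> A"
    and "\<And>x. x \<in> A \<Longrightarrow> \<ominus>\<^bsub>M\<^esub> x \<in> A"
    and "\<And>x y. x \<in> A \<Longrightarrow> y \<in> A \<Longrightarrow> x \<oplus>\<^bsub>M\<^esub> y \<in> A"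
    and "\<And>a x. a \<in> carrier R \<Longrightarrow> x \<in> A \<Longrightarrow> a \<odot>\<^bsub>M\<^esub> x \<in> A"
  shows "submodule A R M"
  using assms by (intro submodule.intro submodule_axioms.intro subgroup.intro) (simp_all flip: a_inv_def)

context En_object
begin

lemma coset_eq_iff:
  assumes j: "j \<le> n" and x: "x \<in> carrier M" and y: "y \<in> carrier M"
  shows "F j +>\<^bsub>M\<^esub> x = F j +>\<^bsub>M\<^esub> y \<longleftrightarrow> x \<ominus>\<^bsub>M\<^esub> y \<in> F j"
proof
  have "\<zero>\<^bsub>M\<^esub> \<oplus>\<^bsub>M\<^esub> x \<in> F j +>\<^bsub>M\<^esub> x" unfolding a_r_coset_def' using chain_zero[OF j] by auto
  then have "x \<in> F j +>\<^bsub>M\<^esub> x" using x by simp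
  moreover assume "F j +>\<^bsub>M\<^esub> x = F j +>\<^bsub>M\<^esub> y"
  ultimately have "x \<in> F j +>\<^bsub>M\<^esub> y" by simp
  then obtain h where h: "h \<in> F j" "x = h \<oplus>\<^bsub>M\<^esub> y" unfolding a_r_coset_def' by auto
  then have "x \<ominus>\<^bsub>M\<^esub> y = h"
    using y chain_carrier[OF j h(1)] by (simp add: a_minus_def M.a_assoc M.r_neg)
  then show "x \<ominus>\<^bsub>M\<^esub> y \<in> F j" using h(1) by simp
next
  assume d: "x \<ominus>\<^bsub>M\<^esub> y \<in> F j"
  have "(x \<ominus>\<^bsub>M\<^esub> y) \<oplus>\<^bsub>M\<^esub> y = x" using x y by (simp add: a_minus_def M.a_assoc M.l_neg)
  then have "x \<in> F j +>\<^bsub>M\<^esub> y" unfolding a_r_coset_def' using d by force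
  then show "F j +>\<^bsub>M\<^esub> x = F j +>\<^bsub>M\<^esub> y"
    using M.a_repr_independence[OF _ y chain_subgroup[OF j]] by simp
qed

lemma chain_step:
  assumes "i \<in> {1..n}"
  shows "i \<le> n" "i - 1 \<le> n" "F (i - 1) \<subseteq> F i"
  using assms chain_mono[of "i - 1"] by (cases i; auto)+

lemma chain_absorb:
  assumes "j \<le> n" "x \<in> carrier M" "h \<in> F j"
  shows "h \<oplus>\<^bsub>M\<^esub> x \<in> F j \<longleftrightarrow> x \<in> F j"
proof
  assume "h \<oplus>\<^bsub>M\<^esub> x \<in> F j"
  then have "\<ominus>\<^bsub>M\<^esub> h \<oplus>\<^bsub>M\<^esub> (h \<oplus>\<^bsub>M\<^esub> x) \<in> F j" using assms chain_add chain_neg by simp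
  then show "x \<in> F j" using assms chain_carrier[of j h] by (simp add: M.r_neg1)
qed (use assms chain_add in simp)

lemma factor_carrier:
  "carrier (factor_module M F i) = (\<lambda>x. F (i - 1) +>\<^bsub>M\<^esub> x) ` F i"
  unfolding factor_module_def quotient_module_def A_RCOSETS_def' a_r_coset_def' by auto

lemma factor_map_coset:
  assumes f: "f \<in> carrier E" and i: "i \<in> {1..n}" and x: "x \<in> F i"
  shows "factor_map M F M F i f (F (i - 1) +>\<^bsub>M\<^esub> x) = F (i - 1) +>\<^bsub>M\<^esub> f x"
proof -
  note le = chain_step(1,2)[OF i]
  have xM: "x \<in> carrier M" using chain_carrier[OF le(1) x] .
  have const: "F (i - 1) +>\<^bsub>M\<^esub> f y = F (i - 1) +>\<^bsub>M\<^esub> f x" if y: "y \<in> F (i - 1) +>\<^bsub>M\<^esub> x" for y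
  proof -
    obtain h where h: "h \<in> F (i - 1)" "y = h \<oplus>\<^bsub>M\<^esub> x" using y unfolding a_r_coset_def' by auto
    have hM: "h \<in> carrier M" using chain_carrier[OF le(2) h(1)] .
    have "f y \<ominus>\<^bsub>M\<^esub> f x = f h"
      unfolding h(2) using E_add[OF f hM xM] E_closed[OF f] hM xM
      by (simp add: a_minus_def M.a_assoc M.r_neg)
    then show ?thesis
      using coset_eq_iff[OF le(2), of "f y" "f x"] E_chain[OF f le(2) h(1)] E_closed[OF f] h(2) hM xM
      by simp
  qed
  have "F (i - 1) +>\<^bsub>M\<^esub> x \<noteq> {}" unfolding a_r_coset_def' using chain_zero[OF le(2)] by auto
  then have "(\<Union>y\<in>F (i - 1) +>\<^bsub>M\<^esub> x. F (i - 1) +>\<^bsub>M\<^esub> f y) = F (i - 1) +>\<^bsub>M\<^esub> f x"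
    using const by (rule SUP_eq_const)
  then show ?thesis unfolding factor_map_def factor_carrier using x by simp
qed

text \<open>The submodules of \<open>F i\<close> that correspond to the kernel and to the image of the morphism induced
  by \<open>f\<close> on \<open>F i / F (i - 1)\<close>: their inverse images under \<open>F i \<rightarrow> F i / F (i - 1)\<close>. The definitions are
  meant for \<open>i \<ge> 1\<close>.\<close>

definition factor_ker :: "nat \<Rightarrow> ('b \<Rightarrow> 'b) \<Rightarrow> 'b set"
  where "factor_ker i f = {x \<in> F i. f x \<in> F (i - 1)}"

definition factor_im :: "nat \<Rightarrow> ('b \<Rightarrow> 'b) \<Rightarrow> 'b set"
  where "factor_im i f = F (i - 1) <+>\<^bsub>M\<^esub> f ` F i"

lemma mem_factor_im: "y \<in> factor_im i f \<longleftrightarrow> (\<exists>w\<in>F (i - 1). \<exists>x\<in>F i. y = w \<oplus>\<^bsub>M\<^esub> f x)"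
  unfolding factor_im_def set_add_def' by auto

lemma factor_imI: "w \<in> F (i - 1) \<Longrightarrow> x \<in> F i \<Longrightarrow> w \<oplus>\<^bsub>M\<^esub> f x \<in> factor_im i f"
  unfolding mem_factor_im by auto

lemma chain_subset_factor_ker:
  assumes "f \<in> carrier E" "i \<in> {1..n}"
  shows "F (i - 1) \<subseteq> factor_ker i f"
  using E_chain[OF assms(1)] chain_step[OF assms(2)] unfolding factor_ker_def by auto

lemma factor_ker_subset: "factor_ker i f \<subseteq> F i"
  unfolding factor_ker_def by auto

lemma chain_subset_factor_im:
  assumes f: "f \<in> carrier E" and i: "i \<in> {1..n}"
  shows "F (i - 1) \<subseteq> factor_im i f"
proof
  fix w assume w: "w \<in> F (i - 1)"
  then have "w = w \<oplus>\<^bsub>M\<^esub> f \<zero>\<^bsub>M\<^esub>" using E_zero[OF f] chain_carrier[OF chain_step(2)[OF i]] by simp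
  then show "w \<in> factor_im i f" using mem_factor_im w chain_zero[OF chain_step(1)[OF i]] by auto
qed

lemma factor_im_subset:
  assumes f: "f \<in> carrier E" and i: "i \<in> {1..n}"
  shows "factor_im i f \<subseteq> F i"
  using E_chain[OF f] chain_add chain_step[OF i] unfolding mem_factor_im subset_iff by auto

lemma factor_ker_submodule:
  assumes f: "f \<in> carrier E" and i: "i \<in> {1..n}"
  shows "submodule (factor_ker i f) R M"
proof (rule submoduleI)
  note le = chain_step(1,2)[OF i]
  note c = chain_carrier[OF le(1)]
  show "factor_ker i f \<subseteq> carrier M" using c unfolding factor_ker_def by auto
  show "\<zero>\<^bsub>M\<^esub> \<in> factor_ker i f"
    unfolding factor_ker_def using E_zero[OF f] chain_zero[OF le(1)] chain_zero[OF le(2)] by simp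
  show "\<ominus>\<^bsub>M\<^esub> x \<in> factor_ker i f" if "x \<in> factor_ker i f" for x
    using that c[of x] E_neg[OF f] chain_neg[OF le(1)] chain_neg[OF le(2)]
    unfolding factor_ker_def by simp
  show "x \<oplus>\<^bsub>M\<^esub> y \<in> factor_ker i f" if "x \<in> factor_ker i f" "y \<in> factor_ker i f" for x y
    using that c[of x] c[of y] E_add[OF f] chain_add[OF le(1)] chain_add[OF le(2)]
    unfolding factor_ker_def by simp
  show "a \<odot>\<^bsub>M\<^esub> x \<in> factor_ker i f" if "a \<in> carrier R" "x \<in> factor_ker i f" for a x
    using that c[of x] E_smult[OF f] chain_smult[OF le(1)] chain_smult[OF le(2)]
    unfolding factor_ker_def by simp
qed

lemma factor_im_submodule:
  assumes f: "f \<in> carrier E" and i: "i \<in> {1..n}"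
  shows "submodule (factor_im i f) R M"
proof (rule submoduleI)
  note le = chain_step(1,2)[OF i]
  note c = chain_carrier[OF le(1)] and c' = chain_carrier[OF le(2)]
  show "factor_im i f \<subseteq> carrier M" using c factor_im_subset[OF f i] by auto
  show "\<zero>\<^bsub>M\<^esub> \<in> factor_im i f" using chain_subset_factor_im[OF f i] chain_zero[OF le(2)] by auto
  show "\<ominus>\<^bsub>M\<^esub> y \<in> factor_im i f" if y: "y \<in> factor_im i f" for y
  proof -
    obtain w x where wx: "w \<in> F (i - 1)" "x \<in> F i" "y = w \<oplus>\<^bsub>M\<^esub> f x"
      using y unfolding mem_factor_im by auto
    then have "\<ominus>\<^bsub>M\<^esub> y = \<ominus>\<^bsub>M\<^esub> w \<oplus>\<^bsub>M\<^esub> f (\<ominus>\<^bsub>M\<^esub> x)"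
      using c[of x] c'[of w] E_closed[OF f, of x] by (simp add: M.minus_add E_neg[OF f])
    moreover have "\<ominus>\<^bsub>M\<^esub> w \<oplus>\<^bsub>M\<^esub> f (\<ominus>\<^bsub>M\<^esub> x) \<in> factor_im i f"
      by (rule factor_imI[OF chain_neg[OF le(2) wx(1)] chain_neg[OF le(1) wx(2)]])
    ultimately show ?thesis by simp
  qed
  show "y \<oplus>\<^bsub>M\<^esub> z \<in> factor_im i f" if y: "y \<in> factor_im i f" and z: "z \<in> factor_im i f" for y z
  proof -
    obtain w x where wx: "w \<in> F (i - 1)" "x \<in> F i" "y = w \<oplus>\<^bsub>M\<^esub> f x"
      using y unfolding mem_factor_im by auto
    obtain v u where vu: "v \<in> F (i - 1)" "u \<in> F i" "z = v \<oplus>\<^bsub>M\<^esub> f u"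
      using z unfolding mem_factor_im by auto
    have "y \<oplus>\<^bsub>M\<^esub> z = (w \<oplus>\<^bsub>M\<^esub> v) \<oplus>\<^bsub>M\<^esub> f (x \<oplus>\<^bsub>M\<^esub> u)"
      using wx vu c[of x] c[of u] c'[of w] c'[of v] E_closed[OF f, of x] E_closed[OF f, of u]
      by (simp add: E_add[OF f] M.a_ac)
    moreover have "(w \<oplus>\<^bsub>M\<^esub> v) \<oplus>\<^bsub>M\<^esub> f (x \<oplus>\<^bsub>M\<^esub> u) \<in> factor_im i f"
      by (rule factor_imI[OF chain_add[OF le(2) wx(1) vu(1)] chain_add[OF le(1) wx(2) vu(2)]])
    ultimately show ?thesis by simp
  qed
  show "a \<odot>\<^bsub>M\<^esub> y \<in> factor_im i f" if a: "a \<in> carrier R" and y: "y \<in> factor_im i f" for a y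
  proof -
    obtain w x where wx: "w \<in> F (i - 1)" "x \<in> F i" "y = w \<oplus>\<^bsub>M\<^esub> f x"
      using y unfolding mem_factor_im by auto
    then have "a \<odot>\<^bsub>M\<^esub> y = a \<odot>\<^bsub>M\<^esub> w \<oplus>\<^bsub>M\<^esub> f (a \<odot>\<^bsub>M\<^esub> x)"
      using a c[of x] c'[of w] E_closed[OF f, of x] by (simp add: rsmult_add_vector E_smult[OF f])
    moreover have "a \<odot>\<^bsub>M\<^esub> w \<oplus>\<^bsub>M\<^esub> f (a \<odot>\<^bsub>M\<^esub> x) \<in> factor_im i f"
      by (rule factor_imI[OF chain_smult[OF le(2) a wx(1)] chain_smult[OF le(1) a wx(2)]])
    ultimately show ?thesis by simp
  qed
qed

lemma mem_I_m:
  assumes i: "i \<in> {1..n}"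
  shows "f \<in> I_m R n M F i \<longleftrightarrow> f \<in> carrier E \<and> factor_ker i f \<noteq> F (i - 1)"
proof (cases "f \<in> carrier E")
  case f: True
  note le = chain_step(1,2)[OF i]
  have c: "x \<in> carrier M" if "x \<in> F i" for x using chain_carrier[OF le(1) that] .
  have inj: "inj_on (factor_map M F M F i f) (carrier (factor_module M F i)) \<longleftrightarrow>
      (\<forall>x\<in>F i. \<forall>y\<in>F i. f x \<ominus>\<^bsub>M\<^esub> f y \<in> F (i - 1) \<longrightarrow> x \<ominus>\<^bsub>M\<^esub> y \<in> F (i - 1))"
    unfolding factor_carrier inj_on_def
    using factor_map_coset[OF f i] coset_eq_iff[OF le(2)] c E_closed[OF f] by simp
  also have "\<dots> \<longleftrightarrow> factor_ker i f \<subseteq> F (i - 1)"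
  proof (intro iffI subsetI ballI impI)
    fix x assume x: "x \<in> factor_ker i f"
      and *: "\<forall>x\<in>F i. \<forall>y\<in>F i. f x \<ominus>\<^bsub>M\<^esub> f y \<in> F (i - 1) \<longrightarrow> x \<ominus>\<^bsub>M\<^esub> y \<in> F (i - 1)"
    have "x \<in> F i" "f x \<in> F (i - 1)" using x by (auto simp: factor_ker_def)
    moreover have "y \<ominus>\<^bsub>M\<^esub> \<zero>\<^bsub>M\<^esub> = y" if "y \<in> carrier M" for y
      using that by (simp add: a_minus_def a_inv_def)
    ultimately show "x \<in> F (i - 1)"
      using *[rule_format, of x "\<zero>\<^bsub>M\<^esub>"] chain_zero[OF le(1)] c[of x] E_closed[OF f, of x]
      by (simp add: E_zero[OF f])
  next
    fix x y assume *: "factor_ker i f \<subseteq> F (i - 1)" and xy: "x \<in> F i" "y \<in> F i"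
      and d: "f x \<ominus>\<^bsub>M\<^esub> f y \<in> F (i - 1)"
    have "x \<ominus>\<^bsub>M\<^esub> y \<in> F i" unfolding a_minus_def using xy chain_add[OF le(1)] chain_neg[OF le(1)] by simp
    then have "x \<ominus>\<^bsub>M\<^esub> y \<in> factor_ker i f"
      unfolding factor_ker_def using d E_minus[OF f] c xy by simp
    then show "x \<ominus>\<^bsub>M\<^esub> y \<in> F (i - 1)" using * by auto
  qed
  also have "\<dots> \<longleftrightarrow> factor_ker i f = F (i - 1)" using chain_subset_factor_ker[OF f i] by auto
  finally show ?thesis unfolding I_m_def using f by simp
qed (simp add: I_m_def)

lemma mem_I_e:
  assumes i: "i \<in> {1..n}"
  shows "f \<in> I_e R n M F i \<longleftrightarrow> f \<in> carrier E \<and> factor_im i f \<noteq> F i"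
proof (cases "f \<in> carrier E")
  case f: True
  note le = chain_step(1,2)[OF i]
  have c: "x \<in> carrier M" if "x \<in> F i" for x using chain_carrier[OF le(1) that] .
  have im: "factor_map M F M F i f ` carrier (factor_module M F i) = (\<lambda>x. F (i - 1) +>\<^bsub>M\<^esub> f x) ` F i"
    unfolding factor_carrier image_image using factor_map_coset[OF f i] by simp
  have "factor_map M F M F i f ` carrier (factor_module M F i) \<subseteq> carrier (factor_module M F i)"
    unfolding im unfolding factor_carrier using E_chain[OF f le(1)] by auto
  then have "factor_map M F M F i f ` carrier (factor_module M F i) = carrier (factor_module M F i) \<longleftrightarrow>
      carrier (factor_module M F i) \<subseteq> factor_map M F M F i f ` carrier (factor_module M F i)"
    by (simp add: set_eq_subset)
  also have "\<dots> \<longleftrightarrow> (\<forall>y\<in>F i. \<exists>x\<in>F i. F (i - 1) +>\<^bsub>M\<^esub> y = F (i - 1) +>\<^bsub>M\<^esub> f x)"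
    unfolding im unfolding factor_carrier by auto
  also have "\<dots> \<longleftrightarrow> (\<forall>y\<in>F i. \<exists>x\<in>F i. y \<ominus>\<^bsub>M\<^esub> f x \<in> F (i - 1))"
    using coset_eq_iff[OF le(2)] c E_closed[OF f] by simp
  also have "\<dots> \<longleftrightarrow> F i \<subseteq> factor_im i f"
  proof -
    have "(\<exists>x\<in>F i. y \<ominus>\<^bsub>M\<^esub> f x \<in> F (i - 1)) \<longleftrightarrow> y \<in> factor_im i f" if y: "y \<in> F i" for y
    proof
      assume "\<exists>x\<in>F i. y \<ominus>\<^bsub>M\<^esub> f x \<in> F (i - 1)"
      then obtain x where x: "x \<in> F i" "y \<ominus>\<^bsub>M\<^esub> f x \<in> F (i - 1)" by auto
      have "y = (y \<ominus>\<^bsub>M\<^esub> f x) \<oplus>\<^bsub>M\<^esub> f x"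
        using c[OF y] c[OF x(1)] E_closed[OF f] by (simp add: a_minus_def M.a_assoc M.l_neg)
      then show "y \<in> factor_im i f" using x mem_factor_im by auto
    next
      assume "y \<in> factor_im i f"
      then obtain w x where wx: "w \<in> F (i - 1)" "x \<in> F i" "y = w \<oplus>\<^bsub>M\<^esub> f x"
        unfolding mem_factor_im by auto
      have "y \<ominus>\<^bsub>M\<^esub> f x = w"
        unfolding wx(3) using chain_carrier[OF le(2) wx(1)] c[OF wx(2)] E_closed[OF f]
        by (simp add: a_minus_def M.a_assoc M.r_neg)
      then show "\<exists>x\<in>F i. y \<ominus>\<^bsub>M\<^esub> f x \<in> F (i - 1)" using wx(1,2) by auto
    qed
    then show ?thesis by auto
  qed
  also have "\<dots> \<longleftrightarrow> factor_im i f = F i" using factor_im_subset[OF f i] by auto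
  finally show ?thesis unfolding I_e_def using f by simp
qed (simp add: I_e_def)

text \<open>A five lemma for chains: bijectivity on the factors lifts to \<open>M\<close> by induction along the chain,
  and it lifts to each \<open>F j\<close>, so that the inverse respects the chain.\<close>

lemma E_Units_if_factors_bij:
  assumes f: "f \<in> carrier E"
    and ker: "\<And>i. i \<in> {1..n} \<Longrightarrow> factor_ker i f = F (i - 1)"
    and im: "\<And>i. i \<in> {1..n} \<Longrightarrow> factor_im i f = F i"
  shows "f \<in> Units E"
proof (rule E_UnitsI[OF f])
  have kernel: "x = \<zero>\<^bsub>M\<^esub>" if "x \<in> F j" "f x = \<zero>\<^bsub>M\<^esub>" "j \<le> n" for j x
    using that
  proof (induction j)
    case 0
    then show ?case using chain_bot by simp
  next
    case (Suc j)
    have "x \<in> factor_ker (Suc j) f" unfolding factor_ker_def using Suc.prems chain_zero by simp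
    then have "x \<in> F j" using ker[of "Suc j"] Suc.prems(3) by simp
    then show ?case using Suc.IH Suc.prems by simp
  qed
  show "inj_on f (carrier M)"
  proof (rule inj_onI)
    fix x y assume xy: "x \<in> carrier M" "y \<in> carrier M" "f x = f y"
    have "f (x \<ominus>\<^bsub>M\<^esub> y) = \<zero>\<^bsub>M\<^esub>"
      using E_minus[OF f] xy E_closed[OF f] by (simp add: a_minus_def M.r_neg)
    then have "x \<ominus>\<^bsub>M\<^esub> y = \<zero>\<^bsub>M\<^esub>" using kernel[of "x \<ominus>\<^bsub>M\<^esub> y" n] chain_top xy by simp
    then have "(x \<ominus>\<^bsub>M\<^esub> y) \<oplus>\<^bsub>M\<^esub> y = y" using xy(2) by simp
    then show "x = y" using xy(1,2) by (simp add: a_minus_def M.a_assoc M.l_neg)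
  qed
  show "F j \<subseteq> f ` F j" if "j \<le> n" for j
    using that
  proof (induction j)
    case 0
    then show ?case using chain_bot E_zero[OF f] by simp
  next
    case (Suc j)
    show ?case
    proof
      fix y assume "y \<in> F (Suc j)"
      then have "y \<in> factor_im (Suc j) f" using im[of "Suc j"] Suc.prems by simp
      then obtain w x where wx: "w \<in> F j" "x \<in> F (Suc j)" "y = w \<oplus>\<^bsub>M\<^esub> f x"
        unfolding mem_factor_im by auto
      obtain v where v: "v \<in> F j" "w = f v" using Suc.IH Suc.prems wx(1) by auto
      have vS: "v \<in> F (Suc j)" using chain_mono[of j] Suc.prems v(1) by auto
      have "y = f (v \<oplus>\<^bsub>M\<^esub> x)"
        unfolding wx(3) v(2) using E_add[OF f] chain_carrier[OF Suc.prems] vS wx(2) by simp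
      then show "y \<in> f ` F (Suc j)" using chain_add[OF Suc.prems vS wx(2)] by simp
    qed
  qed
qed

text \<open>One half of the correspondence theorem, for submodules of \<open>F i\<close>.\<close>

lemma factor_submodule:
  assumes i: "i \<in> {1..n}" and A: "submodule A R M" "A \<subseteq> F i"
  shows "submodule ((\<lambda>x. F (i - 1) +>\<^bsub>M\<^esub> x) ` A) R (factor_module M F i)"
proof -
  note le = chain_step(1,2)[OF i]
  let ?G = "(add_monoid M)\<lparr>carrier := F i\<rparr>"
  have G: "comm_group ?G"
    using subgroup.subgroup_is_group[OF chain_subgroup[OF le(1)] M.a_group] chain_carrier[OF le(1)]
    by (intro group.group_comm_groupI) (simp_all add: M.a_comm)
  interpret G: comm_group ?G by (rule G)
  have sub: "subgroup H ?G" if "subgroup H (add_monoid M)" "H \<subseteq> F i" for H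
    using M.add.subgroup_incl[OF that(1) chain_subgroup[OF le(1)] that(2)] .
  interpret N: normal "F (i - 1)" ?G
    using G.subgroup_imp_normal[OF sub[OF chain_subgroup[OF le(2)] chain_step(3)[OF i]]] .
  have add_eq: "carrier (factor_module M F i) = carrier (?G Mod F (i - 1))"
    "add (factor_module M F i) = mult (?G Mod F (i - 1))"
    "\<zero>\<^bsub>factor_module M F i\<^esub> = \<one>\<^bsub>?G Mod F (i - 1)\<^esub>"
    unfolding factor_module_def quotient_module_def FactGroup_def A_RCOSETS_def set_add_def by simp_all
  \<comment> \<open>The records \<open>add_monoid (factor_module M F i)\<close> and \<open>?G Mod F (i - 1)\<close> differ only in the fields
    that extend a monoid, and these do not affect inverses.\<close>
  have inv_eq: "m_inv (add_monoid (factor_module M F i)) = m_inv (?G Mod F (i - 1))"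
    by (rule ext) (simp add: m_inv_def add_eq)
  have coset_eq: "F (i - 1) #>\<^bsub>?G\<^esub> x = F (i - 1) +>\<^bsub>M\<^esub> x" for x
    by (simp add: a_r_coset_def r_coset_def)
  interpret h: group_hom ?G "?G Mod F (i - 1)" "\<lambda>x. F (i - 1) #>\<^bsub>?G\<^esub> x"
    using N.r_coset_hom_Mod G.group_axioms N.factorgroup_is_group
    by (intro group_hom.intro group_hom_axioms.intro)
  have "subgroup ((\<lambda>x. F (i - 1) #>\<^bsub>?G\<^esub> x) ` A) (?G Mod F (i - 1))"
    by (rule h.subgroup_img_is_subgroup[OF sub[OF submodule.axioms(1)[OF A(1)] A(2)]])
  then have "subgroup ((\<lambda>x. F (i - 1) +>\<^bsub>M\<^esub> x) ` A) (add_monoid (factor_module M F i))"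
    unfolding coset_eq subgroup_def inv_eq by (simp add: add_eq)
  moreover have "a \<odot>\<^bsub>factor_module M F i\<^esub> C \<in> (\<lambda>x. F (i - 1) +>\<^bsub>M\<^esub> x) ` A"
    if a: "a \<in> carrier R" and C: "C \<in> (\<lambda>x. F (i - 1) +>\<^bsub>M\<^esub> x) ` A" for a C
  proof -
    obtain x where x: "x \<in> A" "C = F (i - 1) +>\<^bsub>M\<^esub> x" using C by auto
    have xM: "x \<in> carrier M" using x(1) A(2) chain_carrier[OF le(1)] by auto
    have const: "F (i - 1) +>\<^bsub>M\<^esub> (a \<odot>\<^bsub>M\<^esub> y) = F (i - 1) +>\<^bsub>M\<^esub> (a \<odot>\<^bsub>M\<^esub> x)" if y: "y \<in> C" for y
    proof -
      obtain h where h: "h \<in> F (i - 1)" "y = h \<oplus>\<^bsub>M\<^esub> x"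
        using y unfolding x(2) a_r_coset_def' by auto
      have hM: "h \<in> carrier M" using chain_carrier[OF le(2) h(1)] .
      have "(a \<odot>\<^bsub>M\<^esub> y) \<ominus>\<^bsub>M\<^esub> (a \<odot>\<^bsub>M\<^esub> x) = a \<odot>\<^bsub>M\<^esub> h"
        unfolding h(2) using rsmult_add_vector[OF a hM xM] rsmult_closed[OF a] hM xM
        by (simp add: a_minus_def M.a_assoc M.r_neg)
      then show ?thesis
        using coset_eq_iff[OF le(2), of "a \<odot>\<^bsub>M\<^esub> y" "a \<odot>\<^bsub>M\<^esub> x"] chain_smult[OF le(2) a h(1)]
          rsmult_closed[OF a] h(2) hM xM by simp
    qed
    have "C \<noteq> {}" unfolding x(2) a_r_coset_def' using chain_zero[OF le(2)] by auto
    then have "(\<Union>y\<in>C. F (i - 1) +>\<^bsub>M\<^esub> (a \<odot>\<^bsub>M\<^esub> y)) = F (i - 1) +>\<^bsub>M\<^esub> (a \<odot>\<^bsub>M\<^esub> x)"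
      using const by (rule SUP_eq_const)
    moreover have "a \<odot>\<^bsub>factor_module M F i\<^esub> C = (\<Union>y\<in>C. F (i - 1) +>\<^bsub>M\<^esub> (a \<odot>\<^bsub>M\<^esub> y))"
      unfolding factor_module_def quotient_module_def a_r_coset_def' by simp
    ultimately show ?thesis using submodule.smult_closed[OF A(1) a x(1)] by simp
  qed
  ultimately show ?thesis by (intro submodule.intro submodule_axioms.intro)
qed

end

context Un_object
begin

lemma chain_strict:
  assumes i: "i \<in> {1..n}"
  shows "F (i - 1) \<noteq> F i"
proof
  assume eq: "F (i - 1) = F i"
  have "F (i - 1) +>\<^bsub>M\<^esub> x = F (i - 1)" if "x \<in> F i" for x
    using M.a_coset_join2[OF chain_carrier[OF chain_step(1)[OF i] that] chain_subgroup[OF chain_step(2)[OF i]]]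
      that eq by simp
  moreover have "F i \<noteq> {}" using chain_zero[OF chain_step(1)[OF i]] by auto
  ultimately have "carrier (factor_module M F i) = {F (i - 1)}" unfolding factor_carrier by auto
  moreover have "\<zero>\<^bsub>factor_module M F i\<^esub> = F (i - 1)"
    unfolding factor_module_def quotient_module_def by simp
  ultimately show False using factor_nonzero[OF i] by simp
qed

text \<open>Uniseriality of a factor module, stated without cosets.\<close>

lemma chain_uniserial:
  assumes i: "i \<in> {1..n}"
    and A: "submodule A R M" "F (i - 1) \<subseteq> A" "A \<subseteq> F i"
    and B: "submodule B R M" "F (i - 1) \<subseteq> B" "B \<subseteq> F i"
  shows "A \<subseteq> B \<or> B \<subseteq> A"
proof -
  note le = chain_step(1,2)[OF i]
  have sub: "X \<subseteq> Y"
    if XY: "(\<lambda>x. F (i - 1) +>\<^bsub>M\<^esub> x) ` X \<subseteq> (\<lambda>x. F (i - 1) +>\<^bsub>M\<^esub> x) ` Y"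
      and X: "X \<subseteq> F i" and Y: "submodule Y R M" "F (i - 1) \<subseteq> Y" "Y \<subseteq> F i" for X Y
  proof
    fix x assume x: "x \<in> X"
    then obtain y where y: "y \<in> Y" "F (i - 1) +>\<^bsub>M\<^esub> x = F (i - 1) +>\<^bsub>M\<^esub> y" using XY by auto
    have M: "x \<in> carrier M" "y \<in> carrier M" using x y(1) X Y(3) chain_carrier[OF le(1)] by auto
    then have "x \<ominus>\<^bsub>M\<^esub> y \<in> Y" using coset_eq_iff[OF le(2)] y(2) Y(2) by auto
    then have "(x \<ominus>\<^bsub>M\<^esub> y) \<oplus>\<^bsub>M\<^esub> y \<in> Y"
      using subgroup.m_closed[OF submodule.axioms(1)[OF Y(1)]] y(1) by simp
    then show "x \<in> Y" using M by (simp add: a_minus_def M.a_assoc M.l_neg)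
  qed
  have "(\<lambda>x. F (i - 1) +>\<^bsub>M\<^esub> x) ` A \<subseteq> (\<lambda>x. F (i - 1) +>\<^bsub>M\<^esub> x) ` B \<or>
      (\<lambda>x. F (i - 1) +>\<^bsub>M\<^esub> x) ` B \<subseteq> (\<lambda>x. F (i - 1) +>\<^bsub>M\<^esub> x) ` A"
    using factor_uniserial[OF i] factor_submodule[OF i A(1,3)] factor_submodule[OF i B(1,3)]
    unfolding uniserial_def by simp
  then show ?thesis using sub[OF _ A(3) B] sub[OF _ B(3) A] by auto
qed

end

section \<open>The ideals of endomorphisms with non-injective or non-surjective factor\<close>

text \<open>The equivalence in \<open>mult\<close> combines closure under multiplication from both sides with complete
  primeness.\<close>

lemma (in ring) completely_prime_idealI:
  assumes "P \<subseteq> carrier R" "\<zero> \<in> P" "\<one> \<notin> P"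
    and add: "\<And>x y. x \<in> P \<Longrightarrow> y \<in> P \<Longrightarrow> x \<oplus> y \<in> P"
    and mult: "\<And>x y. x \<in> carrier R \<Longrightarrow> y \<in> carrier R \<Longrightarrow> x \<otimes> y \<in> P \<longleftrightarrow> x \<in> P \<or> y \<in> P"
  shows "completely_prime_ideal P R"
proof -
  have neg: "\<ominus> x \<in> P" if "x \<in> P" for x
  proof -
    have x: "x \<in> carrier R" using that assms(1) by auto
    have "\<ominus> x = \<ominus> \<one> \<otimes> x" using x by (simp add: l_minus)
    then show ?thesis using mult[of "\<ominus> \<one>" x] x that by simp
  qed
  have "ideal P R"
  proof (rule idealI)
    show "subgroup P (add_monoid R)"
      by (rule add.subgroupI) (use assms(1,2) neg add in auto)
  qed (use mult assms(1) ring_axioms in auto)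
  moreover have "P \<noteq> carrier R" using assms(3) by auto
  ultimately show ?thesis
    by (intro completely_prime_ideal.intro completely_prime_ideal_axioms.intro) (use mult in auto)
qed

context Un_object
begin

text \<open>A composite of endomorphisms of a nonzero uniserial module is injective only if both factors
  are: if the left factor is not injective, its kernel meets the nonzero image of the right one.\<close>

lemma I_m_mult:
  assumes i: "i \<in> {1..n}" and f: "f \<in> carrier E" and g: "g \<in> carrier E"
  shows "f \<otimes>\<^bsub>E\<^esub> g \<in> I_m R n M F i \<longleftrightarrow> f \<in> I_m R n M F i \<or> g \<in> I_m R n M F i"
proof -
  note le = chain_step(1,2)[OF i] and fg = E_mult_closed[OF f g]
  have c: "x \<in> carrier M" if "x \<in> F i" for x using chain_carrier[OF le(1) that] .
  have ker_iff: "factor_ker i h = F (i - 1) \<longleftrightarrow> (\<forall>x\<in>F i. h x \<in> F (i - 1) \<longrightarrow> x \<in> F (i - 1))"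
    if h: "h \<in> carrier E" for h
    using chain_subset_factor_ker[OF h i] unfolding factor_ker_def by auto
  have fg_apply: "(f \<otimes>\<^bsub>E\<^esub> g) x = f (g x)" if "x \<in> F i" for x
    using c[OF that] by (simp add: E_mult_apply)
  have comp: "factor_ker i (f \<otimes>\<^bsub>E\<^esub> g) = F (i - 1)"
    if "factor_ker i f = F (i - 1)" "factor_ker i g = F (i - 1)"
    using that E_chain[OF g le(1)] fg_apply unfolding ker_iff[OF f] ker_iff[OF g] ker_iff[OF fg]
    by simp
  have right: "factor_ker i g = F (i - 1)" if "factor_ker i (f \<otimes>\<^bsub>E\<^esub> g) = F (i - 1)"
    using that E_chain[OF f le(2)] fg_apply unfolding ker_iff[OF g] ker_iff[OF fg] by simp
  have left: "factor_ker i f = F (i - 1)" if comp: "factor_ker i (f \<otimes>\<^bsub>E\<^esub> g) = F (i - 1)"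
  proof (rule ccontr)
    assume "factor_ker i f \<noteq> F (i - 1)"
    then obtain x where x: "x \<in> factor_ker i f" "x \<notin> F (i - 1)"
      using chain_subset_factor_ker[OF f i] by auto
    obtain y where y: "y \<in> F i" "y \<notin> F (i - 1)"
      using chain_strict[OF i] chain_step(3)[OF i] by auto
    have gy: "g y \<notin> F (i - 1)" using right[OF comp] y unfolding ker_iff[OF g] by auto
    have gy_im: "g y \<in> factor_im i g"
      using factor_imI[OF chain_zero[OF le(2)] y(1), of g] E_closed[OF g] c[OF y(1)] by simp
    have "factor_ker i f \<subseteq> factor_im i g \<or> factor_im i g \<subseteq> factor_ker i f"
      by (intro chain_uniserial[OF i] factor_ker_submodule factor_im_submodule
          chain_subset_factor_ker chain_subset_factor_im factor_ker_subset factor_im_subset f g i)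
    then obtain z where z: "z \<in> factor_ker i f" "z \<in> factor_im i g" "z \<notin> F (i - 1)"
      using x gy gy_im by auto
    obtain w u where wu: "w \<in> F (i - 1)" "u \<in> F i" "z = w \<oplus>\<^bsub>M\<^esub> g u"
      using z(2) unfolding mem_factor_im by auto
    have gu: "g u \<in> carrier M" using E_closed[OF g] c[OF wu(2)] by simp
    have "f w \<oplus>\<^bsub>M\<^esub> f (g u) \<in> F (i - 1)"
      using z(1) E_add[OF f chain_carrier[OF le(2) wu(1)] gu] unfolding factor_ker_def wu(3) by simp
    then have "f (g u) \<in> F (i - 1)"
      using chain_absorb[OF le(2) E_closed[OF f gu] E_chain[OF f le(2) wu(1)]] by simp
    then have "u \<in> F (i - 1)" using comp wu(2) fg_apply[OF wu(2)] unfolding ker_iff[OF fg] by simp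
    then have "z \<in> F (i - 1)" unfolding wu(3)
      using chain_add[OF le(2) wu(1) E_chain[OF g le(2)]] by simp
    then show False using z(3) by simp
  qed
  show ?thesis unfolding mem_I_m[OF i] using f g fg comp left right by auto
qed

text \<open>Dually, if a composite is surjective then the image of the right factor and the kernel of the
  left one span the module, and the kernel alone cannot.\<close>

lemma I_e_mult:
  assumes i: "i \<in> {1..n}" and f: "f \<in> carrier E" and g: "g \<in> carrier E"
  shows "f \<otimes>\<^bsub>E\<^esub> g \<in> I_e R n M F i \<longleftrightarrow> f \<in> I_e R n M F i \<or> g \<in> I_e R n M F i"
proof -
  note le = chain_step(1,2)[OF i] and fg = E_mult_closed[OF f g]
  have c: "x \<in> carrier M" if "x \<in> F i" for x using chain_carrier[OF le(1) that] .
  have im_iff: "factor_im i h = F i \<longleftrightarrow> F i \<subseteq> factor_im i h" if h: "h \<in> carrier E" for h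
    using factor_im_subset[OF h i] by auto
  have fg_apply: "(f \<otimes>\<^bsub>E\<^esub> g) x = f (g x)" if "x \<in> F i" for x
    using c[OF that] by (simp add: E_mult_apply)
  have comp: "factor_im i (f \<otimes>\<^bsub>E\<^esub> g) = F i" if im: "factor_im i f = F i" "factor_im i g = F i"
    unfolding im_iff[OF fg]
  proof
    fix z assume "z \<in> F i"
    then have "z \<in> factor_im i f" using im by simp
    then obtain w y where wy: "w \<in> F (i - 1)" "y \<in> F i" "z = w \<oplus>\<^bsub>M\<^esub> f y"
      unfolding mem_factor_im by auto
    have "y \<in> factor_im i g" using im wy(2) by simp
    then obtain v x where vx: "v \<in> F (i - 1)" "x \<in> F i" "y = v \<oplus>\<^bsub>M\<^esub> g x"
      unfolding mem_factor_im by auto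
    have M: "w \<in> carrier M" "v \<in> carrier M" "g x \<in> carrier M"
      using chain_carrier[OF le(2)] wy(1) vx(1) E_closed[OF g] c[OF vx(2)] by simp_all
    have "z = (w \<oplus>\<^bsub>M\<^esub> f v) \<oplus>\<^bsub>M\<^esub> (f \<otimes>\<^bsub>E\<^esub> g) x"
      unfolding wy(3) vx(3) fg_apply[OF vx(2)] using E_add[OF f] E_closed[OF f] M
      by (simp add: M.a_assoc)
    moreover have "w \<oplus>\<^bsub>M\<^esub> f v \<in> F (i - 1)"
      using chain_add[OF le(2) wy(1) E_chain[OF f le(2) vx(1)]] .
    ultimately show "z \<in> factor_im i (f \<otimes>\<^bsub>E\<^esub> g)" using factor_imI[OF _ vx(2)] by simp
  qed
  have left: "factor_im i f = F i" if comp: "factor_im i (f \<otimes>\<^bsub>E\<^esub> g) = F i"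
    unfolding im_iff[OF f]
  proof
    fix z assume "z \<in> F i"
    then have "z \<in> factor_im i (f \<otimes>\<^bsub>E\<^esub> g)" using comp by simp
    then obtain w x where wx: "w \<in> F (i - 1)" "x \<in> F i" "z = w \<oplus>\<^bsub>M\<^esub> (f \<otimes>\<^bsub>E\<^esub> g) x"
      unfolding mem_factor_im by auto
    then show "z \<in> factor_im i f"
      using factor_imI[OF wx(1) E_chain[OF g le(1) wx(2)], of f] fg_apply[OF wx(2)] by simp
  qed
  have right: "factor_im i g = F i" if comp: "factor_im i (f \<otimes>\<^bsub>E\<^esub> g) = F i"
  proof -
    have span: "z \<in> factor_im i g"
      if sub: "factor_ker i f \<subseteq> factor_im i g" and z: "z \<in> F i" for z
    proof -
      have "f z \<in> factor_im i (f \<otimes>\<^bsub>E\<^esub> g)" using comp E_chain[OF f le(1) z] by simp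
      then obtain w x where wx: "w \<in> F (i - 1)" "x \<in> F i" "f z = w \<oplus>\<^bsub>M\<^esub> f (g x)"
        unfolding mem_factor_im using fg_apply by auto
      have gx: "g x \<in> F i" using E_chain[OF g le(1) wx(2)] .
      have "f (z \<ominus>\<^bsub>M\<^esub> g x) = w"
        using E_minus[OF f c[OF z] c[OF gx]] wx(3) chain_carrier[OF le(2) wx(1)]
          E_closed[OF f c[OF gx]] by (simp add: a_minus_def M.a_assoc M.r_neg)
      moreover have "z \<ominus>\<^bsub>M\<^esub> g x \<in> F i"
        unfolding a_minus_def using chain_add[OF le(1) z chain_neg[OF le(1) gx]] .
      ultimately have "z \<ominus>\<^bsub>M\<^esub> g x \<in> factor_im i g"
        using wx(1) sub unfolding factor_ker_def by auto
      then obtain v u where vu: "v \<in> F (i - 1)" "u \<in> F i" "z \<ominus>\<^bsub>M\<^esub> g x = v \<oplus>\<^bsub>M\<^esub> g u"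
        unfolding mem_factor_im by auto
      have M: "v \<in> carrier M" "u \<in> carrier M" "x \<in> carrier M"
        using chain_carrier[OF le(2) vu(1)] c[OF vu(2)] c[OF wx(2)] by simp_all
      have "z = (z \<ominus>\<^bsub>M\<^esub> g x) \<oplus>\<^bsub>M\<^esub> g x"
        using c[OF z] c[OF gx] by (simp add: a_minus_def M.a_assoc M.l_neg)
      also have "\<dots> = v \<oplus>\<^bsub>M\<^esub> g (u \<oplus>\<^bsub>M\<^esub> x)"
        unfolding vu(3) using E_add[OF g M(2,3)] E_closed[OF g] M by (simp add: M.a_assoc)
      finally show ?thesis using factor_imI[OF vu(1) chain_add[OF le(1) vu(2) wx(2)], of g] by simp
    qed
    have "factor_ker i f \<subseteq> factor_im i g \<or> factor_im i g \<subseteq> factor_ker i f"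
      by (intro chain_uniserial[OF i] factor_ker_submodule factor_im_submodule
          chain_subset_factor_ker chain_subset_factor_im factor_ker_subset factor_im_subset f g i)
    then show ?thesis
    proof
      assume "factor_ker i f \<subseteq> factor_im i g"
      then show ?thesis using span unfolding im_iff[OF g] by auto
    next
      assume sub: "factor_im i g \<subseteq> factor_ker i f"
      have "F i \<subseteq> F (i - 1)"
      proof
        fix z assume "z \<in> F i"
        then have "z \<in> factor_im i (f \<otimes>\<^bsub>E\<^esub> g)" using comp by simp
        then obtain w x where wx: "w \<in> F (i - 1)" "x \<in> F i" "z = w \<oplus>\<^bsub>M\<^esub> f (g x)"
          unfolding mem_factor_im using fg_apply by auto
        have "g x \<in> factor_im i g"
          using factor_imI[OF chain_zero[OF le(2)] wx(2), of g] E_closed[OF g] c[OF wx(2)] by simp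
        then have "f (g x) \<in> F (i - 1)" using sub unfolding factor_ker_def by auto
        then show "z \<in> F (i - 1)" unfolding wx(3) using chain_add[OF le(2) wx(1)] by simp
      qed
      then show ?thesis using chain_strict[OF i] chain_step(3)[OF i] by auto
    qed
  qed
  show ?thesis unfolding mem_I_e[OF i] using f g fg comp left right by auto
qed

lemma I_m_completely_prime:
  assumes i: "i \<in> {1..n}"
  shows "completely_prime_ideal (I_m R n M F i) E"
proof (rule ring.completely_prime_idealI[OF E_ring])
  note le = chain_step(1,2)[OF i]
  have c: "x \<in> carrier M" if "x \<in> F i" for x using chain_carrier[OF le(1) that] .
  show "I_m R n M F i \<subseteq> carrier E" using mem_I_m[OF i] by auto
  have "factor_ker i \<zero>\<^bsub>E\<^esub> = F i"
    unfolding factor_ker_def E_zero_apply using c chain_zero[OF le(2)] by auto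
  then show "\<zero>\<^bsub>E\<^esub> \<in> I_m R n M F i"
    unfolding mem_I_m[OF i] using E_zero_closed chain_strict[OF i] by auto
  have "factor_ker i \<one>\<^bsub>E\<^esub> = F (i - 1)"
    unfolding factor_ker_def E_one_apply using c chain_step(3)[OF i] by auto
  then show "\<one>\<^bsub>E\<^esub> \<notin> I_m R n M F i" unfolding mem_I_m[OF i] by simp
  show "f \<otimes>\<^bsub>E\<^esub> g \<in> I_m R n M F i \<longleftrightarrow> f \<in> I_m R n M F i \<or> g \<in> I_m R n M F i"
    if "f \<in> carrier E" "g \<in> carrier E" for f g
    using I_m_mult[OF i that] .
  fix f g assume "f \<in> I_m R n M F i" "g \<in> I_m R n M F i"
  then have f: "f \<in> carrier E" "factor_ker i f \<noteq> F (i - 1)"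
    and g: "g \<in> carrier E" "factor_ker i g \<noteq> F (i - 1)" unfolding mem_I_m[OF i] by auto
  \<comment> \<open>The smaller of the two kernels is contained in the kernel of the sum.\<close>
  have "factor_ker i f \<subseteq> factor_ker i g \<or> factor_ker i g \<subseteq> factor_ker i f"
    by (intro chain_uniserial[OF i] factor_ker_submodule chain_subset_factor_ker factor_ker_subset
        f(1) g(1) i)
  then obtain x where x: "x \<in> factor_ker i f" "x \<in> factor_ker i g" "x \<notin> F (i - 1)"
    using f(2) g(2) chain_subset_factor_ker[OF f(1) i] chain_subset_factor_ker[OF g(1) i] by auto
  then have "(f \<oplus>\<^bsub>E\<^esub> g) x \<in> F (i - 1)"
    unfolding factor_ker_def E_add_apply using c[of x] chain_add[OF le(2)] by simp
  then have "x \<in> factor_ker i (f \<oplus>\<^bsub>E\<^esub> g)" using x(1) unfolding factor_ker_def by simp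
  then show "f \<oplus>\<^bsub>E\<^esub> g \<in> I_m R n M F i"
    unfolding mem_I_m[OF i] using E_add_closed[OF f(1) g(1)] x(3) by auto
qed

lemma I_e_completely_prime:
  assumes i: "i \<in> {1..n}"
  shows "completely_prime_ideal (I_e R n M F i) E"
proof (rule ring.completely_prime_idealI[OF E_ring])
  note le = chain_step(1,2)[OF i]
  have c: "x \<in> carrier M" if "x \<in> F i" for x using chain_carrier[OF le(1) that] .
  have c': "x \<in> carrier M" if "x \<in> F (i - 1)" for x using chain_carrier[OF le(2) that] .
  show "I_e R n M F i \<subseteq> carrier E" using mem_I_e[OF i] by auto
  have "factor_im i \<zero>\<^bsub>E\<^esub> \<subseteq> F (i - 1)"
    unfolding subset_iff mem_factor_im E_zero_apply using c c' by auto
  then show "\<zero>\<^bsub>E\<^esub> \<in> I_e R n M F i"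
    unfolding mem_I_e[OF i] using E_zero_closed chain_strict[OF i] chain_step(3)[OF i] by auto
  have "x \<in> factor_im i \<one>\<^bsub>E\<^esub>" if "x \<in> F i" for x
    using factor_imI[OF chain_zero[OF le(2)] that, of "\<one>\<^bsub>E\<^esub>"] c[OF that] by (simp add: E_one_apply)
  then show "\<one>\<^bsub>E\<^esub> \<notin> I_e R n M F i"
    unfolding mem_I_e[OF i] using factor_im_subset[OF E_one_closed i] by auto
  show "f \<otimes>\<^bsub>E\<^esub> g \<in> I_e R n M F i \<longleftrightarrow> f \<in> I_e R n M F i \<or> g \<in> I_e R n M F i"
    if "f \<in> carrier E" "g \<in> carrier E" for f g
    using I_e_mult[OF i that] .
  fix f g assume "f \<in> I_e R n M F i" "g \<in> I_e R n M F i"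
  then have f: "f \<in> carrier E" "factor_im i f \<noteq> F i"
    and g: "g \<in> carrier E" "factor_im i g \<noteq> F i" unfolding mem_I_e[OF i] by auto
  \<comment> \<open>The image of the sum is contained in the larger of the two images.\<close>
  have sum: "factor_im i (f \<oplus>\<^bsub>E\<^esub> g) \<subseteq> A"
    if A: "submodule A R M" "factor_im i f \<subseteq> A" "factor_im i g \<subseteq> A" for A
  proof
    fix z assume "z \<in> factor_im i (f \<oplus>\<^bsub>E\<^esub> g)"
    then obtain w x where wx: "w \<in> F (i - 1)" "x \<in> F i" "z = w \<oplus>\<^bsub>M\<^esub> (f \<oplus>\<^bsub>E\<^esub> g) x"
      unfolding mem_factor_im by auto
    have M: "w \<in> carrier M" "f x \<in> carrier M" "g x \<in> carrier M"
      using c'[OF wx(1)] c[OF wx(2)] E_closed[OF f(1)] E_closed[OF g(1)] by simp_all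
    have "w \<oplus>\<^bsub>M\<^esub> f x \<in> A" using factor_imI[OF wx(1,2)] A(2) by auto
    moreover have "g x \<in> A" using factor_imI[OF chain_zero[OF le(2)] wx(2), of g] A(3) M(3) by auto
    ultimately have "(w \<oplus>\<^bsub>M\<^esub> f x) \<oplus>\<^bsub>M\<^esub> g x \<in> A"
      using subgroup.m_closed[OF submodule.axioms(1)[OF A(1)]] by simp
    then show "z \<in> A" unfolding wx(3) using c[OF wx(2)] M by (simp add: E_add_apply M.a_assoc)
  qed
  have "factor_im i f \<subseteq> factor_im i g \<or> factor_im i g \<subseteq> factor_im i f"
    by (intro chain_uniserial[OF i] factor_im_submodule chain_subset_factor_im factor_im_subset
        f(1) g(1) i)
  then have "factor_im i (f \<oplus>\<^bsub>E\<^esub> g) \<subseteq> factor_im i f \<or> factor_im i (f \<oplus>\<^bsub>E\<^esub> g) \<subseteq> factor_im i g"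
    using sum[OF factor_im_submodule[OF f(1) i]] sum[OF factor_im_submodule[OF g(1) i]] by auto
  then have "factor_im i (f \<oplus>\<^bsub>E\<^esub> g) \<noteq> F i"
    using f(2) g(2) factor_im_subset[OF f(1) i] factor_im_subset[OF g(1) i] by auto
  then show "f \<oplus>\<^bsub>E\<^esub> g \<in> I_e R n M F i"
    unfolding mem_I_e[OF i] using E_add_closed[OF f(1) g(1)] by simp
qed

lemma E_completely_prime_cover:
  "completely_prime_cover E (I_m R n M F ` {1..n} \<union> I_e R n M F ` {1..n})"
proof (intro completely_prime_cover.intro completely_prime_cover_axioms.intro)
  show "ring E" by (rule E_ring)
  show "I_m R n M F ` {1..n} \<union> I_e R n M F ` {1..n} \<noteq> {}" using n_pos by simp
  show "completely_prime_ideal P E" if "P \<in> I_m R n M F ` {1..n} \<union> I_e R n M F ` {1..n}" for P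
    using that I_m_completely_prime I_e_completely_prime by auto
  fix f assume f: "f \<in> carrier E"
    and "\<And>P. P \<in> I_m R n M F ` {1..n} \<union> I_e R n M F ` {1..n} \<Longrightarrow> f \<notin> P"
  then have "f \<notin> I_m R n M F i" "f \<notin> I_e R n M F i" if "i \<in> {1..n}" for i
    using that by simp_all
  then show "f \<in> Units E"
    using E_Units_if_factors_bij[OF f] f mem_I_m mem_I_e by simp
qed simp

end

theorem theorem2p2:
  fixes R :: "('a, 'r) ring_scheme"
    and n :: nat
    and M :: "('a, 'b, 'm) module_scheme"
    and F :: "nat \<Rightarrow> 'b set"
  assumes "Un_object R n M F"
  shows "let E = En_End R n M F; Im = I_m R n M F; Ie = I_e R n M F in
    (\<forall>i\<in>{1..n}. completely_prime_ideal (Im i) E \<and> completely_prime_ideal (Ie i) E) \<and>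
    (\<forall>K. right_ideal K E \<and> K \<noteq> carrier E \<longrightarrow> (\<exists>i\<in>{1..n}. K \<subseteq> Im i \<or> K \<subseteq> Ie i)) \<and>
    (\<forall>K. left_ideal K E \<and> K \<noteq> carrier E \<longrightarrow> (\<exists>i\<in>{1..n}. K \<subseteq> Im i \<or> K \<subseteq> Ie i)) \<and>
    (\<exists>k D. 1 \<le> k \<and> k \<le> 2 * n \<and>
      (\<forall>j\<in>{1..k}. skew_field (D j)) \<and>
      D ` {1..k} \<subseteq> (\<lambda>i. E Quot Im i) ` {1..n} \<union> (\<lambda>i. E Quot Ie i) ` {1..n} \<and>
      E Quot jacobson_radical E \<simeq> RDirProd_list (map D [1..<Suc k]))"
proof -
  interpret Un_object R n M F by (rule assms)
  let ?P = "I_m R n M F ` {1..n} \<union> I_e R n M F ` {1..n}"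
  interpret C: completely_prime_cover "En_End R n M F" ?P by (rule E_completely_prime_cover)
  have sub: "C.maximals \<subseteq> ?P" unfolding C.maximals_def by auto
  define k where "k = card C.maximals"
  have fin: "finite C.maximals" using finite_subset[OF sub] by simp
  have "k \<noteq> 0" unfolding k_def using C.maximals_nonempty fin by simp
  then obtain m where m: "k = Suc m" by (cases k) auto
  have "k \<le> card ?P" unfolding k_def by (rule card_mono[OF _ sub]) simp
  also have "\<dots> \<le> card (I_m R n M F ` {1..n}) + card (I_e R n M F ` {1..n})" by (rule card_Un_le)
  also have "\<dots> \<le> 2 * n"
    using card_image_le[of "{1..n}" "I_m R n M F"] card_image_le[of "{1..n}" "I_e R n M F"] by simp
  finally have k_le: "k \<le> 2 * n" .
  obtain I where I: "bij_betw I {..<Suc m} C.maximals"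
    using ex_bij_betw_nat_finite[OF fin] m unfolding k_def lessThan_atLeast0 by auto
  define D where "D j = E Quot I (j - 1)" for j
  have mem: "I (j - 1) \<in> C.maximals" if "j \<in> {1..k}" for j
    using bij_betwE[OF I] that m by auto
  have "map D [1..<Suc k] = map (\<lambda>i. E Quot I i) [0..<Suc m]"
    unfolding m map_Suc_upt[symmetric] D_def One_nat_def by (simp del: upt_Suc)
  then have iso: "E Quot jacobson_radical E \<simeq> RDirProd_list (map D [1..<Suc k])"
    using C.Quot_jacobson_radical_iso[OF I] by simp
  have skew: "skew_field (D j)" if "j \<in> {1..k}" for j
    unfolding D_def by (rule C.maximals_skew_field[OF mem[OF that]])
  have D_sub: "D ` {1..k} \<subseteq> (\<lambda>i. E Quot I_m R n M F i) ` {1..n} \<union> (\<lambda>i. E Quot I_e R n M F i) ` {1..n}"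
  proof
    fix X assume "X \<in> D ` {1..k}"
    then obtain j where j: "j \<in> {1..k}" "X = E Quot I (j - 1)" unfolding D_def by auto
    have "I (j - 1) \<in> ?P" using mem[OF j(1)] sub by (rule rev_subsetD)
    then show "X \<in> (\<lambda>i. E Quot I_m R n M F i) ` {1..n} \<union> (\<lambda>i. E Quot I_e R n M F i) ` {1..n}"
      unfolding j(2) by auto
  qed
  have one_sided: "\<exists>i\<in>{1..n}. K \<subseteq> I_m R n M F i \<or> K \<subseteq> I_e R n M F i"
    if "right_ideal K E \<or> left_ideal K E" "K \<noteq> carrier E" for K
  proof -
    have "\<exists>P\<in>?P. K \<subseteq> P"
      using that C.right_ideal_subset_cover[of K] C.left_ideal_subset_cover[of K] by auto
    then show ?thesis by auto
  qed
  have "1 \<le> k" using m by simp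
  then have "\<exists>k D. 1 \<le> k \<and> k \<le> 2 * n \<and> (\<forall>j\<in>{1..k}. skew_field (D j)) \<and>
      D ` {1..k} \<subseteq> (\<lambda>i. E Quot I_m R n M F i) ` {1..n} \<union> (\<lambda>i. E Quot I_e R n M F i) ` {1..n} \<and>
      E Quot jacobson_radical E \<simeq> RDirProd_list (map D [1..<Suc k])"
    using k_le skew D_sub iso by (intro exI[of _ k] exI[of _ D]) simp
  then show ?thesis
    unfolding Let_def using I_m_completely_prime I_e_completely_prime one_sided by simp
qed

end
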